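(* Let $E$ be an elliptic curve over a field $K$, $P\in E(K)$, and let $m=d_1d_2>1$ be composite with $d_1,d_2>1$ coprime proper divisors of $m$, where $\operatorname{char}K\nmid m$. If $\delta_m^P$ is reducible over $K$, then $\delta_{d_1}^P$ or $\delta_{d_2}^P$ is reducible over $K$.
   Context: For $E$ with Weierstrass coordinate functions $x,y$ and $m\in\mathbb{Z}$, $\psi_m$ is the $m$-th division polynomial ($\psi_m^2\in K[x]$), $\theta_m=x\psi_m^2-\psi_{m+1}\psi_{m-1}$, so $x([m]R)=\theta_m(x(R))/\psi_m^2(x(R))$; and $\delta_m^P=\theta_m-x(P)\psi_m^2$ if $P\ne O$, $\delta_m^P=\psi_m^2$ if $P=O$. *)

theory Defs
  imports "HOL-Computational_Algebra.Polynomial" "HOL-Computational_Algebra.Polynomial_Factorial"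
begin

text \<open>A (general) Weierstrass curve y^2 + a1 x y + a3 y = x^3 + a2 x^2 + a4 x + a6 over a field.\<close>

datatype 'a wcurve = WCurve (wa1: 'a) (wa2: 'a) (wa3: 'a) (wa4: 'a) (wa6: 'a)

definition wb2 :: "'a::comm_ring_1 wcurve \<Rightarrow> 'a" where
  "wb2 E = wa1 E ^ 2 + 4 * wa2 E"
definition wb4 :: "'a::comm_ring_1 wcurve \<Rightarrow> 'a" where
  "wb4 E = 2 * wa4 E + wa1 E * wa3 E"
definition wb6 :: "'a::comm_ring_1 wcurve \<Rightarrow> 'a" where
  "wb6 E = wa3 E ^ 2 + 4 * wa6 E"
definition wb8 :: "'a::comm_ring_1 wcurve \<Rightarrow> 'a" where
  "wb8 E = wa1 E ^ 2 * wa6 E + 4 * wa2 E * wa6 E - wa1 E * wa3 E * wa4 E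
           + wa2 E * wa3 E ^ 2 - wa4 E ^ 2"

definition wdisc :: "'a::comm_ring_1 wcurve \<Rightarrow> 'a" where
  "wdisc E = - (wb2 E ^ 2 * wb8 E) - 8 * wb4 E ^ 3 - 27 * wb6 E ^ 2
             + 9 * wb2 E * wb4 E * wb6 E"

definition elliptic_curve :: "'a::field wcurve \<Rightarrow> bool" where
  "elliptic_curve E \<longleftrightarrow> wdisc E \<noteq> 0"

text \<open>K-rational points: None is the point at infinity O, Some (x,y) an affine point.\<close>
definition on_curve :: "'a::comm_ring_1 wcurve \<Rightarrow> ('a \<times> 'a) option \<Rightarrow> bool" where
  "on_curve E P = (case P of None \<Rightarrow> True
     | Some (x, y) \<Rightarrow> y ^ 2 + wa1 E * x * y + wa3 E * y
                       = x ^ 3 + wa2 E * x ^ 2 + wa4 E * x + wa6 E)"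

text \<open>psi_2^2 = 4x^3 + b2 x^2 + 2 b4 x + b6, as a polynomial in x.\<close>
definition wF :: "'a::comm_ring_1 wcurve \<Rightarrow> 'a poly" where
  "wF E = [:wb6 E, 2 * wb4 E, wb2 E, 4:]"

text \<open>Reduced division polynomials: psi_m = psit m for m odd and psi_m = psi_2 * psit m
  for m even (psi_2 = 2y + a1 x + a3), so that psit m is in K[x].  The recursion is the
  standard one psi_{2k+1} = psi_{k+2} psi_k^3 - psi_{k-1} psi_{k+1}^3,
  psi_2 psi_{2k} = psi_k (psi_{k+2} psi_{k-1}^2 - psi_{k-2} psi_{k+1}^2),
  rewritten using psi_2^2 = wF.\<close>
function psit :: "'a::comm_ring_1 wcurve \<Rightarrow> nat \<Rightarrow> 'a poly" where
  "psit E n =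
    (if n = 0 then 0
     else if n = 1 then 1
     else if n = 2 then 1
     else if n = 3 then [:wb8 E, 3 * wb6 E, 3 * wb4 E, wb2 E, 3:]
     else if n = 4 then [:wb4 E * wb8 E - wb6 E ^ 2, wb2 E * wb8 E - wb4 E * wb6 E,
                          10 * wb8 E, 10 * wb6 E, 5 * wb4 E, wb2 E, 2:]
     else if odd n then
       (if even (n div 2) then
          wF E ^ 2 * psit E (n div 2 + 2) * psit E (n div 2) ^ 3
            - psit E (n div 2 - 1) * psit E (n div 2 + 1) ^ 3
        else
          psit E (n div 2 + 2) * psit E (n div 2) ^ 3
            - wF E ^ 2 * psit E (n div 2 - 1) * psit E (n div 2 + 1) ^ 3)
     else
       psit E (n div 2) * (psit E (n div 2 + 2) * psit E (n div 2 - 1) ^ 2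
                           - psit E (n div 2 - 2) * psit E (n div 2 + 1) ^ 2))"
  by pat_completeness auto
termination
  by (relation "measure (\<lambda>(E, n). n)") (auto elim!: oddE evenE)

definition psi_sq :: "'a::comm_ring_1 wcurve \<Rightarrow> nat \<Rightarrow> 'a poly" where
  "psi_sq E m = (if even m then wF E else 1) * psit E m ^ 2"

text \<open>theta_m = x psi_m^2 - psi_{m+1} psi_{m-1} (for m \<ge> 1).\<close>
definition theta :: "'a::comm_ring_1 wcurve \<Rightarrow> nat \<Rightarrow> 'a poly" where
  "theta E m = [:0, 1:] * psi_sq E m
     - (if odd m then wF E else 1) * psit E (m + 1) * psit E (m - 1)"

definition delta :: "'a::comm_ring_1 wcurve \<Rightarrow> ('a \<times> 'a) option \<Rightarrow> nat \<Rightarrow> 'a poly" where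
  "delta E P m = (case P of None \<Rightarrow> psi_sq E m
                  | Some (x, y) \<Rightarrow> theta E m - [:x:] * psi_sq E m)"

definition reducible_poly :: "'a::field poly \<Rightarrow> bool" where
  "reducible_poly p \<longleftrightarrow> degree p > 0 \<and> \<not> irreducible p"

end

(*
  If P = O, the odd one of d1, d2 gives a proper square.  If P = (x, y), assume that
  the deltas of d1 and d2 are irreducible and let a be a root of delta_m in an algebraic closure
  of K.  Since x([d1 d2]R) = x([d1][d2]R), the element b = theta_{d2}(a) / psi_{d2}(a)^2 of K(a)
  is a root of delta_{d1}, so d1^2 = [K(b) : K] divides [K(a) : K].  The denominator does not
  vanish at a, because otherwise a would be a common root of theta_{d2} and psi_{d2}^2, hence of
  delta_{d2}, and the irreducible delta_{d2} would divide the nonzero psi_{d2}^2 of smaller degree.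
  Symmetrically d2^2 divides [K(a) : K], so by coprimality [K(a) : K] = m^2 = deg delta_m.

  The composition law x([mn]R) = x([m][n]R) is proved for division polynomials alone, without
  the group law: the recursion implies the Somos-4 relation together with a conserved quantity,
  these imply Ward's relation, and therefore k |-> psi_{kn} / psi_n again satisfies the division
  recursion, now for the same curve at the abscissa theta_n / psi_n^2, so that only k = 2, 3, 4
  have to be compared.  The divisions by psi_n are legitimate over the generic curve over
  Z[a1, ..., a6], and the resulting polynomial identities specialise to every curve.
*)
theory Submission
  imports "HOL-Algebra.Algebraic_Closure_Type" Defs
begin

section \<open>The Somos-4 recurrence, its conserved quantity and Ward's relation\<close>

subsection \<open>Elliptic divisibility sequences\<close>

text \<open>When \<open>W 1 = 1\<close>, \<open>W 2 ^ 2 = b6\<close> and \<open>W 3 = b8\<close>,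
  this is Ward's relation with second index 2.\<close>

definition somos :: "'a::field \<Rightarrow> 'a \<Rightarrow> (int \<Rightarrow> 'a) \<Rightarrow> int \<Rightarrow> bool" where
  "somos b6 b8 W m \<longleftrightarrow> W (m + 2) * W (m - 2) = b6 * W (m + 1) * W (m - 1) - b8 * W m ^ 2"

text \<open>With \<open>t m = W (m + 1) * W (m - 1) / W m ^ 2\<close> this is the conserved quantity of the
  recurrence \<open>t (m + 1) * t m ^ 2 * t (m - 1) = b6 * t m - b8\<close>, cleared of denominators.\<close>

definition somos_inv :: "'a::field \<Rightarrow> 'a \<Rightarrow> (int \<Rightarrow> 'a) \<Rightarrow> int \<Rightarrow> bool" where
  "somos_inv b4 b6 W m \<longleftrightarrow> W (m + 2) * W (m - 1) ^ 2 + W (m - 2) * W (m + 1) ^ 2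
     = b4 * W (m + 1) * W (m - 1) * W m - b6 * W m ^ 3"

text \<open>If \<open>W\<close> is the sequence of division polynomials at a point R, the right-hand
  side divided by \<open>W a ^ 2 * W b ^ 2\<close> is x([b]R) - x([a]R).\<close>

definition ward :: "(int \<Rightarrow> 'a::field) \<Rightarrow> int \<Rightarrow> int \<Rightarrow> bool" where
  "ward W a b \<longleftrightarrow> W (a + b) * W (a - b)
     = W (a + 1) * W (a - 1) * W b ^ 2 - W (b + 1) * W (b - 1) * W a ^ 2"

text \<open>Expanding the left-hand side with the two relations at \<open>C\<close> gives a polynomial that is
  symmetric under exchanging the two sequences; this is what makes the induction for Ward's
  relation work.  The unqualified method name is shadowed by HOL-Algebra.\<close>

lemma ward_product:
  fixes A B C D E a b c d e :: "'a::field"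
  assumes "E * A = b6 * D * B - b8 * C ^ 2"
    and "E * B ^ 2 + A * D ^ 2 = b4 * D * B * C - b6 * C ^ 3"
    and "e * a = b6 * d * b - b8 * c ^ 2"
    and "e * b ^ 2 + a * d ^ 2 = b4 * d * b * c - b6 * c ^ 3"
  shows "(E * C * c ^ 2 - d * b * D ^ 2) * (C * A * c ^ 2 - d * b * B ^ 2)
       = (D * B * d ^ 2 - e * c * C ^ 2) * (D * B * b ^ 2 - c * a * C ^ 2)"
  using assms by Groebner_Basis.algebra

text \<open>Write b = c + 1. The left-hand sides at (a + 1, c) and (a - 1, c) multiply to the same
  product as those at (a, c + 1) and (a, c - 1); \<open>ward_product\<close> regroups the right-hand
  sides in the same way, and the known factor at (a, c - 1) is cancelled. All hypotheses stop at
  \<open>M\<close>, and \<open>W M\<close> itself may vanish, so the lemma applies to a sequence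
  whose last relevant term is not yet under control.\<close>

lemma ward_if_somos:
  fixes W :: "int \<Rightarrow> 'a::field"
  assumes W0: "W 0 = 0" and W1: "W 1 = 1" and odd: "\<And>n. W (- n) = - W n"
    and nz: "\<And>n. 0 < n \<Longrightarrow> n < M \<Longrightarrow> W n \<noteq> 0"
    and S: "\<And>m. 0 < m \<Longrightarrow> m + 2 \<le> M \<Longrightarrow> somos b6 b8 W m"
    and T: "\<And>m. 0 < m \<Longrightarrow> m + 2 \<le> M \<Longrightarrow> somos_inv b4 b6 W m"
  shows "int b \<le> a \<Longrightarrow> a + int b \<le> M \<Longrightarrow> ward W a (int b)"
proof (induction b arbitrary: a rule: less_induct)
  case (less b)
  consider "b = 0" | "b = 1" | "b \<ge> 2" by linarith
  then show ?case
  proof cases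
    case 1
    then show ?thesis using W0 W1 odd[of 1] by (simp add: ward_def power2_eq_square)
  next
    case 2
    then show ?thesis using W0 W1 by (simp add: ward_def)
  next
    case 3
    define c where "c = int b - 1"
    have c: "c \<ge> 1" "int b = c + 1" "int (b - 1) = c" "int (b - 2) = c - 1"
      using 3 by (auto simp: c_def)
    show ?thesis
    proof (cases "a = int b")
      case True
      then show ?thesis using W0 by (simp add: ward_def)
    next
      case False
      then have a: "a \<ge> c + 2" "a + c + 1 \<le> M" using less.prems c by auto
      have 1: "ward W a (c - 1)" using less.IH[of "b - 2" a] 3 a c by simp
      have 2: "ward W (a + 1) c" using less.IH[of "b - 1" "a + 1"] 3 a c by simp
      have 3: "ward W (a - 1) c" using less.IH[of "b - 1" "a - 1"] 3 a c by simp
      have sa: "somos b6 b8 W a" "somos_inv b4 b6 W a"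
        and sc: "somos b6 b8 W c" "somos_inv b4 b6 W c" using S T a c by auto
      have prod: "(W (a + 2) * W a * W c ^ 2 - W (c + 1) * W (c - 1) * W (a + 1) ^ 2) *
              (W a * W (a - 2) * W c ^ 2 - W (c + 1) * W (c - 1) * W (a - 1) ^ 2)
            = (W (a + 1) * W (a - 1) * W (c + 1) ^ 2 - W (c + 2) * W c * W a ^ 2)
              * (W (a + 1) * W (a - 1) * W (c - 1) ^ 2 - W c * W (c - 2) * W a ^ 2)"
        using sa sc unfolding somos_def somos_inv_def by (rule ward_product)
      have idx: "a + 1 + 1 = a + 2" "a + 1 - 1 = a" "a - 1 - 1 = a - 2" "a - 1 + 1 = a"
        "c - 1 + 1 = c" "c - 1 - 1 = c - 2" "a + (c - 1) = a + c - 1" "a - (c - 1) = a - c + 1"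
        "a + 1 + c = a + c + 1" "a + 1 - c = a - c + 1" "a - 1 + c = a + c - 1" "a - 1 - c = a - c - 1"
        by simp_all
      have "(W (a + c + 1) * W (a - c - 1)) * (W (a + c - 1) * W (a - c + 1))
          = (W (a + 1) * W (a - 1) * W (c + 1) ^ 2 - W (c + 2) * W c * W a ^ 2)
            * (W (a + c - 1) * W (a - c + 1))"
        using 1 2 3 prod unfolding ward_def idx by Groebner_Basis.algebra
      moreover have "W (a + c - 1) * W (a - c + 1) \<noteq> 0" using nz a c by simp
      ultimately have "W (a + c + 1) * W (a - c - 1)
          = W (a + 1) * W (a - 1) * W (c + 1) ^ 2 - W (c + 2) * W c * W a ^ 2"
        by (metis mult_right_cancel)
      then show ?thesis by (simp add: ward_def c algebra_simps)
    qed
  qed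
qed

text \<open>Conservation along the recurrence, for six consecutive terms \<open>a\<close>, ...,
  \<open>f\<close>. After multiplication by \<open>b\<close>, the Somos relations centred at
  \<open>c\<close> and \<open>d\<close> eliminate the outer terms \<open>a\<close> and
  \<open>f\<close>.\<close>

lemma somos_step:
  fixes a b c d e f :: "'a::field"
  assumes "e * a = b6 * d * b - b8 * c ^ 2"
    and "e * b ^ 2 + a * d ^ 2 = b4 * d * b * c - b6 * c ^ 3"
    and "b \<noteq> 0" and "f * b = b6 * e * c - b8 * d ^ 2"
  shows "f * c ^ 2 + b * e ^ 2 = b4 * e * c * d - b6 * d ^ 3"
proof -
  have "b * (f * c ^ 2 + b * e ^ 2) = b * (b4 * e * c * d - b6 * d ^ 3)"
    using assms(1,2,4) by Groebner_Basis.algebra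
  then show ?thesis using assms(3) by simp
qed

lemma psi4_identity:
  fixes z v v' b2 b4 b6 b8 :: "'a::field"
  assumes sum: "z ^ 2 * (v + v') = b4 * z + b6" and prod: "z ^ 2 * (v * v') = - (b6 * z + b8)"
    and b8: "4 * b8 = b2 * b6 - b4 ^ 2"
  shows "z ^ 2 * (v' - v) * (b4 * (z ^ 4 - b4 * z ^ 2 - 2 * b6 * z - b8)
             + b6 * (b6 + 2 * b4 * z + b2 * z ^ 2 + 4 * z ^ 3))
         + 2 * z ^ 4 * (z - v') ^ 2 * (2 * v ^ 2 * z - b4 * v - b6)
       = b6 * (b4 * b8 - b6 ^ 2 + (b2 * b8 - b4 * b6) * z + 10 * b8 * z ^ 2
           + 10 * b6 * z ^ 3 + 5 * b4 * z ^ 4 + b2 * z ^ 5 + 2 * z ^ 6)" (is "?L = ?R")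
proof -
  define T q where "T = z ^ 2 * v" and "q = - (b6 * z + b8)"
  have T': "z ^ 2 * v' = b4 * z + b6 - T"
    using sum by (simp add: T_def algebra_simps)
  have T: "T ^ 2 = (b4 * z + b6) * T - z ^ 2 * q"
    using sum prod unfolding T_def q_def by Groebner_Basis.algebra
  have "z ^ 4 * (z - v') ^ 2 * (2 * v ^ 2 * z - b4 * v - b6)
      = 2 * z ^ 3 * T ^ 2 - 4 * z ^ 2 * (z ^ 2 * (v * v')) * T + 2 * z * (z ^ 2 * (v * v')) ^ 2
        - b4 * (z ^ 4 * T - 2 * z ^ 3 * (z ^ 2 * (v * v')) + (z ^ 2 * v') * (z ^ 2 * (v * v')))
        - b6 * (z ^ 3 - z ^ 2 * v') ^ 2"
    unfolding T_def by Groebner_Basis.algebra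
  then have "?L = (b4 * z + b6 - 2 * T) * (b4 * (z ^ 4 - b4 * z ^ 2 - 2 * b6 * z - b8)
             + b6 * (b6 + 2 * b4 * z + b2 * z ^ 2 + 4 * z ^ 3))
       + 2 * (2 * z ^ 3 * T ^ 2 - 4 * z ^ 2 * q * T + 2 * z * q ^ 2
        - b4 * (z ^ 4 * T - 2 * z ^ 3 * q + (b4 * z + b6 - T) * q)
        - b6 * (z ^ 3 - (b4 * z + b6 - T)) ^ 2)"
    unfolding T' prod q_def[symmetric] using T' unfolding T_def by Groebner_Basis.algebra
  \<comment> \<open>The cofactors of the quadratic equation for \<open>T\<close> and of the relation
    for \<open>b8\<close> are explicit, so this is a plain ring identity; both added terms
    vanish.\<close>
  also have "\<dots> = ?R + (4 * z ^ 3 - 2 * b6) * (T ^ 2 - ((b4 * z + b6) * T - z ^ 2 * q))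
      + (z ^ 5 - b4 * z ^ 3 - b6 * z ^ 2 + 2 * z ^ 2 * T + b8 * z) * (4 * b8 - (b2 * b6 - b4 ^ 2))"
    unfolding q_def by Groebner_Basis.algebra
  finally show ?thesis
    unfolding T b8 diff_self mult_zero_right add_0_right .
qed

text \<open>\<open>W n\<close> stands for the n-th division polynomial at a fixed point \<open>R\<close>, and \<open>b4\<close>, \<open>b6\<close>, \<open>b8\<close>
  for the invariants of the curve translated so that \<open>R\<close> has abscissa 0.\<close>

locale eds =
  fixes W :: "int \<Rightarrow> 'a::field" and b4 b6 b8 :: 'a
  assumes W_0: "W 0 = 0" and W_1: "W 1 = 1" and W_neg: "W (- n) = - W n"
    and W_2: "W 2 ^ 2 = b6" and W_3: "W 3 = b8" and W_4: "W 4 = W 2 * (b4 * b8 - b6 ^ 2)"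
    and W_odd: "k \<ge> 2 \<Longrightarrow> W (2 * k + 1) = W (k + 2) * W k ^ 3 - W (k - 1) * W (k + 1) ^ 3"
    and W_even: "k \<ge> 3 \<Longrightarrow> W (2 * k) * W 2
           = W k * (W (k + 2) * W (k - 1) ^ 2 - W (k - 2) * W (k + 1) ^ 2)"
    and W_pos: "n > 0 \<Longrightarrow> W n \<noteq> 0"
begin

lemma W_nz: "n \<noteq> 0 \<Longrightarrow> W n \<noteq> 0"
  using W_pos[of n] W_pos[of "- n"] W_neg[of n] by (cases "n > 0") auto

lemma somos_base:
  assumes "m = 1 \<or> m = 2" shows "somos b6 b8 W m \<and> somos_inv b4 b6 W m"
proof -
  have "W (-1) = -1" using W_neg[of 1] W_1 by simp
  then show ?thesis using assms W_0 W_1 W_3 W_4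
    by (elim disjE)
      (auto simp: somos_def somos_inv_def power2_eq_square power3_eq_cube algebra_simps simp flip: W_2)
qed

lemma somos_upto:
  "0 < m \<Longrightarrow> m + 2 \<le> int M + 4 \<Longrightarrow> somos b6 b8 W m \<and> somos_inv b4 b6 W m"
proof (induction M arbitrary: m)
  case 0
  then show ?case using somos_base[of m] by (cases "m = 1") auto
next
  case (Suc M)
  show ?case
  proof (cases "m + 2 \<le> int M + 4")
    case True
    then show ?thesis using Suc by auto
  next
    case False
    define N where "N = int M + 5"
    have m: "m = N - 2" and N: "N \<ge> 5" using False Suc.prems by (auto simp: N_def)
    \<comment> \<open>Replace the last term by the one that the Somos relation dictates: Ward's relation holds
      for the modified sequence and shows that nothing was changed.\<close>
    define u where "u = (b6 * W (m + 1) * W (m - 1) - b8 * W m ^ 2) / W (m - 2)"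
    define V where "V = W(N := u, - N := - u)"
    have VW: "V k = W k" if "\<bar>k\<bar> < N" for k using that by (auto simp: V_def)
    have VN: "V N = u" using N by (simp add: V_def)
    have S: "somos b6 b8 W k \<and> somos_inv b4 b6 W k" if "0 < k" "k + 2 < N" for k
      using Suc.IH[of k] that by (simp add: N_def)
    have idx: "m - 1 + 2 = m + 1" "m - 1 - 2 = m - 3" "m - 1 + 1 = m" "m - 1 - 1 = m - 2"
      "m + 2 = N" by (simp_all add: m)
    have Vm: "somos b6 b8 V m"
      using N W_nz[of "m - 2"] unfolding somos_def idx
      by (simp add: VN VW m u_def)
    have Sm: "somos b6 b8 V k \<and> somos_inv b4 b6 V k" if "0 < k" "k + 2 < N" for k
      using S[OF that] that by (simp add: somos_def somos_inv_def VW)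
    have "somos_inv b4 b6 V m"
    proof -
      have "somos b6 b8 V (m - 1)" "somos_inv b4 b6 V (m - 1)" using Sm[of "m - 1"] m N by auto
      moreover have "V (m - 2) \<noteq> 0" using W_nz[of "m - 2"] VW m N by simp
      ultimately show ?thesis using Vm unfolding somos_def somos_inv_def idx
        by (rule somos_step)
    qed
    then have SV: "somos b6 b8 V k" "somos_inv b4 b6 V k" if "0 < k" "k + 2 \<le> N" for k
      using Sm[of k] Vm that m by (cases "k = m"; auto)+
    have ward: "ward V a (int b)" if "int b \<le> a" "a + int b \<le> N" for a b
    proof (rule ward_if_somos[where M = N and ?b4.0 = b4 and ?b6.0 = b6 and ?b8.0 = b8])
      show "V (- n) = - V n" for n
        using W_neg[of n] N by (auto simp: V_def)
    qed (use that SV W_0 W_1 W_pos VW N in auto)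
    \<comment> \<open>Ward's relation for \<open>V\<close> at (k + 1, k - 1) if N = 2k, and at (k +
      1, k) if N = 2k + 1, is the division recursion. All other indices in it are below N, where
      \<open>V\<close> and \<open>W\<close> agree.\<close>
    have "u = W N"
    proof (cases "even N")
      case True
      then obtain k where k: "N = 2 * k" by blast
      have "ward V (k + 1) (k - 1)" using ward[of "nat (k - 1)" "k + 1"] k N by simp
      then have "u * W 2 = W (k + 2) * W k * W (k - 1) ^ 2 - W k * W (k - 2) * W (k + 1) ^ 2"
        using k N by (simp add: ward_def VW algebra_simps flip: VN)
      also have "\<dots> = W N * W 2" using W_even[of k] k N by (simp add: algebra_simps)
      finally show ?thesis using W_nz[of 2] by simp
    next
      case False
      then obtain k where k: "N = 2 * k + 1" using oddE by blast
      have "ward V (k + 1) k" using ward[of "nat k" "k + 1"] k N by simp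
      then have "u = W (k + 2) * W k ^ 3 - W (k - 1) * W (k + 1) ^ 3"
        using k N W_1 by (simp add: ward_def VW algebra_simps power2_eq_square power3_eq_cube flip: VN)
      then show ?thesis using W_odd[of k] k N by simp
    qed
    then have "V = W" using W_neg[of N] by (auto simp: V_def)
    then show ?thesis using SV m N by auto
  qed
qed

lemma W_somos: "m > 0 \<Longrightarrow> W (m + 2) * W (m - 2) = b6 * W (m + 1) * W (m - 1) - b8 * W m ^ 2"
  using somos_upto[of m "nat m"] by (simp add: somos_def)

lemma W_somos_inv: "m > 0 \<Longrightarrow> W (m + 2) * W (m - 1) ^ 2 + W (m - 2) * W (m + 1) ^ 2
     = b4 * W (m + 1) * W (m - 1) * W m - b6 * W m ^ 3"
  using somos_upto[of m "nat m"] by (simp add: somos_inv_def)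

lemma W_ward:
  assumes "0 \<le> b" "b \<le> a"
  shows "W (a + b) * W (a - b)
     = W (a + 1) * W (a - 1) * W b ^ 2 - W (b + 1) * W (b - 1) * W a ^ 2"
proof -
  have "ward W a (int (nat b))"
    by (rule ward_if_somos[where M = "a + b" and ?b4.0 = b4 and ?b6.0 = b6 and ?b8.0 = b8])
       (use assms W_0 W_1 W_neg W_nz W_somos W_somos_inv in \<open>auto simp: somos_def somos_inv_def\<close>)
  then show ?thesis using assms by (simp add: ward_def)
qed

text \<open>Up to squares, each of the three products is a difference of two values of
  \<open>W (k + 1) * W (k - 1) / W k ^ 2\<close>, so the relation telescopes. With
  \<open>c = n\<close> it becomes the recursion along multiples of n.\<close>

lemma W_ward3:
  assumes "0 \<le> c" "c \<le> b" "b \<le> a"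
  shows "W (a + b) * W (a - b) * W c ^ 2
       = W (a + c) * W (a - c) * W b ^ 2 - W (b + c) * W (b - c) * W a ^ 2"
proof -
  have "0 \<le> b" "c \<le> a" using assms by simp_all
  then show ?thesis
    unfolding W_ward[OF \<open>0 \<le> b\<close> assms(3)] W_ward[OF assms(1) \<open>c \<le> a\<close>] W_ward[OF assms(1,2)]
    by Groebner_Basis.algebra
qed


section \<open>Addition, duplication, triplication and quadruplication formulas\<close>

text \<open>\<open>xdiff n\<close> is \<open>x([n]R) - x(R)\<close>, and \<open>eta n\<close> is the value of \<open>2 y + a1 x + a3\<close> at \<open>[n]R\<close>.\<close>

definition xdiff :: "int \<Rightarrow> 'a" where "xdiff n = - (W (n + 1) * W (n - 1)) / W n ^ 2"
definition eta :: "int \<Rightarrow> 'a" where "eta n = W (2 * n) / W n ^ 4"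

lemma W_double: "n > 0 \<Longrightarrow> W (2 * n) = eta n * W n ^ 4"
  using W_pos[of n] by (simp add: eta_def)

lemma W_succ_pred: "n > 0 \<Longrightarrow> W (n + 1) * W (n - 1) = - xdiff n * W n ^ 2"
  using W_pos[of n] by (simp add: xdiff_def)

text \<open>The conserved quantity divided by \<open>W n ^ 3\<close>. Likewise
  \<open>xdiff_prod\<close> is the Somos relation divided by \<open>W n ^ 2\<close>. Together they
  give the symmetric functions of the abscissas of [n]R + R and [n]R - R.\<close>

lemma xdiff_sum:
  assumes "n \<ge> 2"
  shows "xdiff n ^ 2 * (xdiff (n + 1) + xdiff (n - 1)) = b4 * xdiff n + b6"
proof -
  have nz: "W n \<noteq> 0" "W (n + 1) \<noteq> 0" "W (n - 1) \<noteq> 0" using assms W_pos by auto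
  have idx: "n + 1 + 1 = n + 2" "n + 1 - 1 = n" "n - 1 + 1 = n" "n - 1 - 1 = n - 2" by auto
  have "(W (n + 2) * W (n - 1) ^ 2 + W (n - 2) * W (n + 1) ^ 2) / W n ^ 3
       = (b4 * W (n + 1) * W (n - 1) * W n - b6 * W n ^ 3) / W n ^ 3"
    using W_somos_inv[of n] assms by simp
  then show ?thesis using nz unfolding xdiff_def idx
    by (simp add: field_simps power2_eq_square power3_eq_cube) Groebner_Basis.algebra
qed

lemma xdiff_prod:
  assumes "n \<ge> 2"
  shows "xdiff n ^ 2 * (xdiff (n + 1) * xdiff (n - 1)) = - (b6 * xdiff n + b8)"
proof -
  have nz: "W n \<noteq> 0" "W (n + 1) \<noteq> 0" "W (n - 1) \<noteq> 0" using assms W_pos by auto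
  have idx: "n + 1 + 1 = n + 2" "n + 1 - 1 = n" "n - 1 + 1 = n" "n - 1 - 1 = n - 2" by auto
  have "W (n + 2) * W (n - 2) / W n ^ 2
       = (b6 * W (n + 1) * W (n - 1) - b8 * W n ^ 2) / W n ^ 2"
    using W_somos[of n] assms by simp
  then show ?thesis using nz unfolding xdiff_def idx
    by (simp add: field_simps power2_eq_square power3_eq_cube)
qed

text \<open>Ward's relation at (n + 1, n - 1).\<close>

lemma eta_eq:
  assumes "n \<ge> 2"
  shows "eta n * W 2 = xdiff n ^ 2 * (xdiff (n - 1) - xdiff (n + 1))"
proof -
  have nz: "W n \<noteq> 0" "W (n + 1) \<noteq> 0" "W (n - 1) \<noteq> 0" using assms W_pos by auto
  have idx: "n + 1 + 1 = n + 2" "n + 1 - 1 = n" "n - 1 + 1 = n" "n - 1 - 1 = n - 2" by auto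
  have "W (2 * n) * W 2 = W (n + 2) * W n * W (n - 1) ^ 2 - W n * W (n - 2) * W (n + 1) ^ 2"
    using W_ward[of "n - 1" "n + 1"] assms unfolding idx by (simp add: algebra_simps)
  then show ?thesis using nz unfolding xdiff_def eta_def idx
    by (simp add: field_simps power2_eq_square power3_eq_cube power4_eq_xxxx) Groebner_Basis.algebra
qed

lemma W_double_plus:
  assumes "n \<ge> 2"
  shows "W (2 * n + 1) = (xdiff n - xdiff (n + 1)) * W n ^ 2 * W (n + 1) ^ 2"
proof -
  have nz: "W n \<noteq> 0" "W (n + 1) \<noteq> 0" "W (n - 1) \<noteq> 0" using assms W_pos by auto
  have idx: "n + 1 + 1 = n + 2" "n + 1 - 1 = n" by auto
  have "W (2 * n + 1) = W (n + 2) * W n * W n ^ 2 - W (n + 1) * W (n - 1) * W (n + 1) ^ 2"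
    using W_ward[of n "n + 1"] assms W_1 unfolding idx by (simp add: algebra_simps)
  then show ?thesis using nz unfolding xdiff_def idx
    by (simp add: field_simps) Groebner_Basis.algebra
qed

lemma W_double_minus:
  assumes "n \<ge> 2"
  shows "W (2 * n - 1) = (xdiff (n - 1) - xdiff n) * W n ^ 2 * W (n - 1) ^ 2"
proof -
  have nz: "W n \<noteq> 0" "W (n + 1) \<noteq> 0" "W (n - 1) \<noteq> 0" using assms W_pos by auto
  have idx: "n - 1 + 1 = n" "n - 1 - 1 = n - 2" by auto
  have "W (2 * n - 1) = W (n + 1) * W (n - 1) * W (n - 1) ^ 2 - W n * W (n - 2) * W n ^ 2"
    using W_ward[of "n - 1" n] assms W_1 unfolding idx by (simp add: algebra_simps)
  then show ?thesis using nz unfolding xdiff_def idx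
    by (simp add: field_simps) Groebner_Basis.algebra
qed

lemma W_2_nz: "W 2 \<noteq> 0" "b6 \<noteq> 0"
  using W_pos[of 2] W_2 by auto

context
  fixes b2 :: 'a and n :: int
  assumes b8: "4 * b8 = b2 * b6 - b4 ^ 2" and n: "n \<ge> 2"
begin

lemma n_pos: "n > 0" using n by simp

text \<open>By \<open>eta_eq\<close>, \<open>b6 * eta n ^ 2\<close> is the discriminant of a
  quadratic whose coefficients come from \<open>xdiff_sum\<close> and \<open>xdiff_prod\<close>; the
  relation for \<open>b8\<close> makes the factor \<open>b6\<close> visible. The result is the
  equation of the translated curve in terms of 2 y + a1 x + a3.\<close>

lemma eta_square: "eta n ^ 2 = b6 + 2 * b4 * xdiff n + b2 * xdiff n ^ 2 + 4 * xdiff n ^ 3"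
proof -
  have "b6 * eta n ^ 2 = b6 * (b6 + 2 * b4 * xdiff n + b2 * xdiff n ^ 2 + 4 * xdiff n ^ 3)"
    using xdiff_sum[OF n] xdiff_prod[OF n] eta_eq[OF n] W_2 b8 by Groebner_Basis.algebra
  then show ?thesis using W_2_nz by simp
qed

lemma xdiff_double:
  "xdiff (2 * n) * eta n ^ 2 = xdiff n ^ 2 * (xdiff n - xdiff (n + 1)) * (xdiff n - xdiff (n - 1))"
proof -
  have nz: "W n \<noteq> 0" "W (2 * n) \<noteq> 0" using n W_pos by auto
  have "xdiff (2 * n) * W (2 * n) ^ 2 = - (W (2 * n + 1) * W (2 * n - 1))"
    using nz by (simp add: xdiff_def)
  also have "\<dots> = (xdiff n - xdiff (n + 1)) * (xdiff n - xdiff (n - 1)) * W n ^ 4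
                   * (W (n + 1) * W (n - 1)) ^ 2"
    unfolding W_double_plus[OF n] W_double_minus[OF n] by Groebner_Basis.algebra
  also have "\<dots> = xdiff n ^ 2 * (xdiff n - xdiff (n + 1)) * (xdiff n - xdiff (n - 1)) * W n ^ 8"
    unfolding W_succ_pred[OF n_pos] by Groebner_Basis.algebra
  finally show ?thesis using nz n by (simp add: W_double power_mult_distrib flip: power_mult)
qed

text \<open>\<open>xdiff_double\<close> is symmetric in the two neighbours of n, so their symmetric
  functions turn it into the duplication formula of the translated curve.\<close>

lemma xdiff_double':
  "xdiff (2 * n) * eta n ^ 2 = xdiff n ^ 4 - b4 * xdiff n ^ 2 - 2 * b6 * xdiff n - b8"
proof -
  have "xdiff (2 * n) * eta n ^ 2 = xdiff n ^ 4
      - xdiff n * (xdiff n ^ 2 * (xdiff (n + 1) + xdiff (n - 1)))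
      + xdiff n ^ 2 * (xdiff (n + 1) * xdiff (n - 1))"
    unfolding xdiff_double by Groebner_Basis.algebra
  then show ?thesis unfolding xdiff_sum[OF n] xdiff_prod[OF n] by Groebner_Basis.algebra
qed

text \<open>Ward's relation at (2n, n) reduces the claim to \<open>xdiff n - xdiff (2 * n)\<close>,
  hence to duplication. The polynomial factor is psi_3 of the translated curve.\<close>

lemma W_triple:
  "W (3 * n) = W n ^ 9 *
     (b8 + 3 * b6 * xdiff n + 3 * b4 * xdiff n ^ 2 + b2 * xdiff n ^ 3 + 3 * xdiff n ^ 4)"
proof -
  have nz: "W n \<noteq> 0" "W (2 * n) \<noteq> 0" using n W_pos by auto
  have "W (3 * n) * W n = W (2 * n + 1) * W (2 * n - 1) * W n ^ 2 - W (n + 1) * W (n - 1) * W (2 * n) ^ 2"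
    using W_ward[of n "2 * n"] n by simp
  also have "\<dots> = (xdiff n - xdiff (2 * n)) * W (2 * n) ^ 2 * W n ^ 2"
    unfolding W_succ_pred[OF n_pos] using nz by (simp add: xdiff_def field_simps)
  also have "\<dots> = (xdiff n * eta n ^ 2 - xdiff (2 * n) * eta n ^ 2) * W n ^ 9 * W n"
    using n unfolding W_double[of n] by (simp add: W_double) Groebner_Basis.algebra
  also have "xdiff n * eta n ^ 2 - xdiff (2 * n) * eta n ^ 2
      = b8 + 3 * b6 * xdiff n + 3 * b4 * xdiff n ^ 2 + b2 * xdiff n ^ 3 + 3 * xdiff n ^ 4"
    unfolding xdiff_double' unfolding eta_square by Groebner_Basis.algebra
  finally show ?thesis using nz by (simp add: mult.commute)
qed

text \<open>Since \<open>W (4 * n)\<close> is \<open>eta (2 * n) * W (2 * n) ^ 4\<close>, only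
  \<open>eta (2 * n)\<close> is missing. It is expressed by \<open>xdiff (2 * n)\<close> and
  \<open>xdiff (2 * n + 1)\<close>, and the latter by \<open>eta n\<close> and
  \<open>eta (n + 1)\<close>.\<close>

lemma W_quadruple:
  "W (4 * n) = W n ^ 16 * eta n *
     (b4 * b8 - b6 ^ 2 + (b2 * b8 - b4 * b6) * xdiff n + 10 * b8 * xdiff n ^ 2
      + 10 * b6 * xdiff n ^ 3 + 5 * b4 * xdiff n ^ 4 + b2 * xdiff n ^ 5 + 2 * xdiff n ^ 6)"
    (is "_ = _ * _ * ?psi4")
proof -
  have nz: "W n \<noteq> 0" "W (n + 1) \<noteq> 0" "W (2 * n) \<noteq> 0" "W (2 * n + 1) \<noteq> 0" "eta n \<noteq> 0"
    using n W_pos by (auto simp: eta_def)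
  define z v v' where "z = xdiff n" and "v = xdiff (n + 1)" and "v' = xdiff (n - 1)"
  have sum: "z ^ 2 * (v + v') = b4 * z + b6" and prod: "z ^ 2 * (v * v') = - (b6 * z + b8)"
    and eta: "eta n * W 2 = z ^ 2 * (v' - v)"
    using xdiff_sum[OF n] xdiff_prod[OF n] eta_eq[OF n] by (simp_all add: z_def v_def v'_def)
  have "n + 1 \<ge> 2" "2 * n \<ge> 2" using n by auto
  \<comment> \<open>Here and in \<open>eta2\<close>, \<open>xdiff_sum\<close> removes one of the two
    neighbours occurring in \<open>eta_eq\<close>.\<close>
  have eta1: "eta (n + 1) * W 2 = 2 * v ^ 2 * z - b4 * v - b6"
    using xdiff_sum[OF \<open>n + 1 \<ge> 2\<close>] eta_eq[OF \<open>n + 1 \<ge> 2\<close>] unfolding z_def v_def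
    by simp Groebner_Basis.algebra
  have eta2: "eta (2 * n) * W 2 = b4 * xdiff (2 * n) + b6 - 2 * xdiff (2 * n) ^ 2 * xdiff (2 * n + 1)"
    using xdiff_sum[OF \<open>2 * n \<ge> 2\<close>] eta_eq[OF \<open>2 * n \<ge> 2\<close>] by Groebner_Basis.algebra
  have "xdiff (2 * n + 1) * W (2 * n + 1) ^ 2 = - (W (2 * (n + 1)) * W (2 * n))"
    using nz by (simp add: xdiff_def algebra_simps)
  then have "xdiff (2 * n + 1) * (z - v) ^ 2 * (W n ^ 4 * W (n + 1) ^ 4)
           = - (eta (n + 1) * eta n) * (W n ^ 4 * W (n + 1) ^ 4)"
    using n W_double[of "n + 1"] W_double[of n] W_double_plus[OF n] unfolding z_def v_def
    by simp Groebner_Basis.algebra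
  then have x21: "xdiff (2 * n + 1) * (z - v) ^ 2 = - (eta (n + 1) * eta n)"
    using nz by (metis mult_right_cancel no_zero_divisors power_not_zero)
  have x2: "xdiff (2 * n) * eta n ^ 2 = z ^ 2 * (z - v) * (z - v')"
    using xdiff_double by (simp add: z_def v_def v'_def)
  \<comment> \<open>The square of \<open>x2\<close> supplies exactly the factor
    \<open>(z - v) ^ 2\<close> required by \<open>x21\<close>.\<close>
  have "eta n * (eta (2 * n) * W 2 * eta n ^ 3)
      = eta n * (eta n * (b4 * (xdiff (2 * n) * eta n ^ 2) + b6 * eta n ^ 2)
        + 2 * z ^ 4 * (z - v') ^ 2 * eta (n + 1))"
    unfolding eta2 using x2 x21 by Groebner_Basis.algebra
  then have "eta (2 * n) * W 2 * eta n ^ 3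
      = eta n * (b4 * (xdiff (2 * n) * eta n ^ 2) + b6 * eta n ^ 2)
        + 2 * z ^ 4 * (z - v') ^ 2 * eta (n + 1)"
    using nz by simp
  then have "b6 * (eta (2 * n) * eta n ^ 3)
      = (eta n * W 2) * (b4 * (xdiff (2 * n) * eta n ^ 2) + b6 * eta n ^ 2)
        + 2 * z ^ 4 * (z - v') ^ 2 * (eta (n + 1) * W 2)"
    unfolding W_2[symmetric] by Groebner_Basis.algebra
  also have "\<dots> = b6 * ?psi4"
    unfolding xdiff_double' unfolding eta_square eta eta1 z_def[symmetric]
    using sum prod b8 by (rule psi4_identity)
  finally have "eta (2 * n) * eta n ^ 3 = ?psi4" using W_2_nz by simp
  moreover have "W (4 * n) = eta (2 * n) * eta n ^ 3 * eta n * W n ^ 16"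
  proof -
    have "W (4 * n) = eta (2 * n) * W (2 * n) ^ 4" using W_double[of "2 * n"] n_pos by simp
    then show ?thesis unfolding W_double[OF n_pos] by Groebner_Basis.algebra
  qed
  ultimately show ?thesis by simp
qed

end

end

section \<open>Division polynomials at [n]R from those at R, without the group law\<close>

subsection \<open>Division polynomials at a multiple of a point\<close>

declare psit.simps [simp del]

lemma psit_base [simp]:
  "psit E 0 = 0" "psit E (Suc 0) = 1" "psit E 1 = 1" "psit E 2 = 1"
  "psit E 3 = [:wb8 E, 3 * wb6 E, 3 * wb4 E, wb2 E, 3:]"
  "psit E 4 = [:wb4 E * wb8 E - wb6 E ^ 2, wb2 E * wb8 E - wb4 E * wb6 E,
     10 * wb8 E, 10 * wb6 E, 5 * wb4 E, wb2 E, 2:]"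
  by (subst psit.simps; simp)+

lemma psit_odd:
  assumes "k \<ge> 2"
  shows "psit E (2 * k + 1) =
    (if even k then wF E ^ 2 else 1) * psit E (k + 2) * psit E k ^ 3
    - (if even k then 1 else wF E ^ 2) * psit E (k - 1) * psit E (k + 1) ^ 3"
  using assms by (subst psit.simps) auto

lemma psit_even:
  assumes "k \<ge> 3"
  shows "psit E (2 * k) = psit E k * (psit E (k + 2) * psit E (k - 1) ^ 2
                           - psit E (k - 2) * psit E (k + 1) ^ 2)"
  using assms by (subst psit.simps) auto

lemma wb8_relation: "4 * wb8 E = wb2 E * wb6 E - wb4 E ^ 2"
  by (simp add: wb2_def wb4_def wb6_def wb8_def power2_eq_square algebra_simps)

text \<open>Taylor expansion at \<open>x\<close>. The coefficients are built from the invariants of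
  the curve translated so that \<open>x\<close> becomes 0, which matches the form of
  \<open>W_triple\<close>; \<open>psit_4_add\<close> does the same for
  \<open>W_quadruple\<close>.\<close>

lemma psit_3_add:
  "poly (psit E 3) (x + z) = poly (psit E 3) x + 3 * poly (wF E) x * z
     + 3 * (6 * x ^ 2 + wb2 E * x + wb4 E) * z ^ 2 + (12 * x + wb2 E) * z ^ 3 + 3 * z ^ 4"
  for x z :: "'a::idom"
  by (simp add: wF_def) Groebner_Basis.algebra

lemma psit_4_add:
  fixes E :: "'a::idom wcurve" and x z :: 'a
  defines "b2 \<equiv> 12 * x + wb2 E" and "b4 \<equiv> 6 * x ^ 2 + wb2 E * x + wb4 E" and "b6 \<equiv> poly (wF E) x"
    and "b8 \<equiv> poly (psit E 3) x"
  shows "poly (psit E 4) (x + z) = b4 * b8 - b6 ^ 2 + (b2 * b8 - b4 * b6) * z + 10 * b8 * z ^ 2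
      + 10 * b6 * z ^ 3 + 5 * b4 * z ^ 4 + b2 * z ^ 5 + 2 * z ^ 6"
  unfolding b2_def b4_def b6_def b8_def
  by (simp add: wF_def, use wb8_relation[of E] in Groebner_Basis.algebra)

text \<open>The value of the n-th division polynomial at a point with abscissa \<open>x\<close>, where \<open>s\<close> is the
  value of \<open>2 y + a1 x + a3\<close>, a square root of \<open>wF E\<close> at \<open>x\<close>.\<close>

definition psi_at :: "'a::comm_ring_1 wcurve \<Rightarrow> 'a \<Rightarrow> 'a \<Rightarrow> nat \<Rightarrow> 'a" where
  "psi_at E x s n = poly (psit E n) x * (if even n then s else 1)"

lemma psi_at_odd:
  assumes "s ^ 2 = poly (wF E) x" "k \<ge> 2"
  shows "psi_at E x s (2 * k + 1) = psi_at E x s (k + 2) * psi_at E x s k ^ 3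
           - psi_at E x s (k - 1) * psi_at E x s (k + 1) ^ 3"
proof -
  have "odd (k - 1) = even k" using assms by (cases k) auto
  then show ?thesis unfolding psi_at_def psit_odd[OF assms(2)]
    by (cases "even k") (simp_all add: algebra_simps power2_eq_square power3_eq_cube flip: assms(1))
qed

lemma psi_at_even:
  assumes "s ^ 2 = poly (wF E) x" "k \<ge> 3"
  shows "psi_at E x s (2 * k) * psi_at E x s 2 =
    psi_at E x s k * (psi_at E x s (k + 2) * psi_at E x s (k - 1) ^ 2
                           - psi_at E x s (k - 2) * psi_at E x s (k + 1) ^ 2)"
proof -
  have "odd (k - 1) = even k" "odd (k - 2) = odd k" using assms by (cases k; auto)+
  then show ?thesis using assms(2) unfolding psi_at_def psit_even[OF assms(2)]
    by (cases "even k") (simp_all add: algebra_simps power2_eq_square flip: assms(1))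
qed

lemma psi_at_square: "s ^ 2 = poly (wF E) x \<Longrightarrow> psi_at E x s n ^ 2 = poly (psi_sq E n) x"
  by (simp add: psi_at_def psi_sq_def power_mult_distrib)

lemma psi_at_theta:
  assumes "s ^ 2 = poly (wF E) x" "n \<ge> 1"
  shows "poly (theta E n) x = x * psi_at E x s n ^ 2 - psi_at E x s (n + 1) * psi_at E x s (n - 1)"
proof -
  have "odd (n - 1) = even n" using assms by (cases n) auto
  then show ?thesis using assms(1) unfolding psi_at_square[OF assms(1)]
    by (simp add: theta_def psi_at_def power2_eq_square algebra_simps flip: assms(1))
qed

definition psi_int :: "'a::comm_ring_1 wcurve \<Rightarrow> 'a \<Rightarrow> 'a \<Rightarrow> int \<Rightarrow> 'a" where
  "psi_int E x s n = (if n < 0 then - psi_at E x s (nat (- n)) else psi_at E x s (nat n))"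

lemma psi_int_of_nat: "psi_int E x s (int n) = psi_at E x s n"
  by (simp add: psi_int_def)

text \<open>The hypothesis \<open>nz\<close> excludes torsion points; it is later verified at the
  generic point of the generic curve.\<close>

lemma eds_psi:
  fixes E :: "'a::field wcurve"
  assumes s: "s ^ 2 = poly (wF E) x" and nz: "\<And>n. n > 0 \<Longrightarrow> psi_at E x s n \<noteq> 0"
  shows "eds (psi_int E x s) (6 * x ^ 2 + wb2 E * x + wb4 E) (poly (wF E) x) (poly (psit E 3) x)"
proof
  show "psi_int E x s 0 = 0" "psi_int E x s 1 = 1"
    "psi_int E x s 2 ^ 2 = poly (wF E) x" "psi_int E x s 3 = poly (psit E 3) x"
    by (simp_all add: psi_int_def psi_at_def s)
  show "psi_int E x s (- n) = - psi_int E x s n" for n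
    by (auto simp: psi_int_def psi_at_def)
  have "poly (psit E 4) x = (6 * x ^ 2 + wb2 E * x + wb4 E) * poly (psit E 3) x - poly (wF E) x ^ 2"
    by (simp add: wF_def, use wb8_relation[of E] in Groebner_Basis.algebra)
  then show "psi_int E x s 4 = psi_int E x s 2 *
      ((6 * x ^ 2 + wb2 E * x + wb4 E) * poly (psit E 3) x - poly (wF E) x ^ 2)"
    by (simp only: psi_int_def psi_at_def) simp
  show "psi_int E x s n \<noteq> 0" if "n > 0" for n
    using that nz[of "nat n"] by (simp add: psi_int_def)
next
  fix k :: int assume "k \<ge> 2"
  then have "nat (2 * k + 1) = 2 * nat k + 1" "nat (k + 2) = nat k + 2" "nat (k - 1) = nat k - 1"
     "nat (k + 1) = nat k + 1" "2 \<le> nat k" by auto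
  then show "psi_int E x s (2 * k + 1) =
     psi_int E x s (k + 2) * psi_int E x s k ^ 3 - psi_int E x s (k - 1) * psi_int E x s (k + 1) ^ 3"
    using psi_at_odd[OF s, of "nat k"] \<open>k \<ge> 2\<close> by (simp add: psi_int_def)
next
  fix k :: int assume "k \<ge> 3"
  then have "nat (2 * k) = 2 * nat k" "nat (k + 2) = nat k + 2" "nat (k - 1) = nat k - 1"
     "nat (k + 1) = nat k + 1" "nat (k - 2) = nat k - 2" "3 \<le> nat k" by auto
  then show "psi_int E x s (2 * k) * psi_int E x s 2 = psi_int E x s k *
     (psi_int E x s (k + 2) * psi_int E x s (k - 1) ^ 2 - psi_int E x s (k - 2) * psi_int E x s (k + 1) ^ 2)"
    using psi_at_even[OF s, of "nat k"] \<open>k \<ge> 3\<close> by (simp add: psi_int_def)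
qed

text \<open>Removes the powers of \<open>q\<close> from the recursion along multiples of n.
  \<open>K\<close> and \<open>A\<close>, ..., \<open>E\<close> stand for powers
  \<open>q ^ (j ^ 2)\<close>; both monomials carry the same total weight because their sums of
  squared indices agree.\<close>

lemma homogeneous_even:
  fixes q s w :: "'a::field"
  assumes "w * (s * q ^ 4) * q ^ 2 = t5 * A * (t3 * B) * (t2 * C) ^ 2 - t3 * B * (t1 * D) * (t4 * E) ^ 2"
    and "K * q ^ 6 = A * B * C ^ 2" and "K * q ^ 6 = B * D * E ^ 2"
    and "t * s = t3 * (t5 * t2 ^ 2 - t1 * t4 ^ 2)" and "q \<noteq> 0" "s \<noteq> 0"
  shows "w = t * K"
proof -
  have "w * (s * q ^ 6) = t * K * (s * q ^ 6)" using assms(1-4) by Groebner_Basis.algebra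
  then show ?thesis using assms(5,6) by simp
qed

lemma homogeneous_odd:
  fixes q w :: "'a::field"
  assumes "w * q * q ^ 2 = t4 * A * (t2 * B) * (t2 * B) ^ 2 - t3 * C * (t1 * D) * (t3 * C) ^ 2"
    and "K * q ^ 3 = A * B ^ 3" and "K * q ^ 3 = C ^ 3 * D"
    and "t = t4 * t2 ^ 3 - t1 * t3 ^ 3" and "q \<noteq> 0"
  shows "w = t * K"
proof -
  have "w * q ^ 3 = t * K * q ^ 3" using assms(1-4) by Groebner_Basis.algebra
  then show ?thesis using assms(5) by simp
qed

text \<open>Strong induction on \<open>k\<close>: both sides obey the same recursion once the weight
  \<open>k ^ 2\<close> is taken into account, and the cases up to 4 come from
  \<open>W_double\<close>, \<open>W_triple\<close> and \<open>W_quadruple\<close>. The pair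
  \<open>x'\<close>, \<open>s'\<close> replaces the point [n]R.\<close>

lemma psi_composition:
  fixes E :: "'a::field wcurve" and n :: nat
  assumes s: "s ^ 2 = poly (wF E) x" and nz: "\<And>n. n > 0 \<Longrightarrow> psi_at E x s n \<noteq> 0"
    and n: "n \<ge> 2"
  defines "x' \<equiv> x - psi_at E x s (n + 1) * psi_at E x s (n - 1) / psi_at E x s n ^ 2"
    and "s' \<equiv> psi_at E x s (2 * n) / psi_at E x s n ^ 4"
  shows "s' ^ 2 = poly (wF E) x'"
    and "psi_at E x s (k * n) = psi_at E x' s' k * psi_at E x s n ^ (k ^ 2)"
proof -
  define W where "W = psi_int E x s"
  interpret eds W "6 * x ^ 2 + wb2 E * x + wb4 E" "poly (wF E) x" "poly (psit E 3) x"
    unfolding W_def using s nz by (rule eds_psi)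
  have W: "psi_at E x s i = W (int i)" for i by (simp add: W_def psi_int_of_nat)
  have n2: "int n \<ge> 2" and n0: "n > 0" using n by auto
  have x': "x' = x + xdiff (int n)"
    using n by (simp add: x'_def xdiff_def W add.commute of_nat_diff)
  have s': "s' = eta (int n)" by (simp add: s'_def eta_def W)
  have b8: "4 * poly (psit E 3) x = (12 * x + wb2 E) * poly (wF E) x - (6 * x ^ 2 + wb2 E * x + wb4 E) ^ 2"
    by (simp add: wF_def, use wb8_relation[of E] in Groebner_Basis.algebra)
  show s'2: "s' ^ 2 = poly (wF E) x'"
    unfolding s' eta_square[OF b8 n2] x' by (simp add: wF_def) Groebner_Basis.algebra
  have 2: "W (2 * int n) = s' * W (int n) ^ 4" using n0 W_double s' by simp
  have 3: "W (3 * int n) = poly (psit E 3) x' * W (int n) ^ 9"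
    unfolding W_triple[OF b8 n2] x' psit_3_add by (rule mult.commute)
  have 4: "W (4 * int n) = poly (psit E 4) x' * s' * W (int n) ^ 16"
    unfolding W_quadruple[OF b8 n2] x' s' psit_4_add by (simp only: mult_ac)
  define q where "q = W (int n)"
  have q: "q \<noteq> 0" "s' \<noteq> 0" using n W_nz unfolding q_def s' eta_def by auto
  define T where "T = psi_at E x' s'"
  have "W (int k * int n) = T k * q ^ (k ^ 2)"
  proof (induction k rule: less_induct)
    case (less k)
    consider "k \<in> {0,1,2,3,4}" | j where "k = 2 * j" "j \<ge> 3" | j where "k = 2 * j + 1" "j \<ge> 2"
    proof -
      have "k \<in> {0,1,2,3,4} \<or> k \<ge> 5" by auto
      then show thesis using that by (cases "even k") (auto elim!: evenE oddE)
    qed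
    then show ?case
    proof cases
      case 1
      then show ?thesis
        using 2 3 4 W_0 W_1 by (auto simp: T_def psi_at_def q_def)
    next
      case (2 j)
      then obtain i where i: "j = i + 3" using le_Suc_ex by (metis add.commute)
      have IH: "W (int l * int n) = T l * q ^ (l ^ 2)" if "l \<in> {i+1..i+5}" for l
        using that less.IH[of l] 2 i by auto
      \<comment> \<open>The three-index relation for the multiples j + 1, j - 1 and 1 of n; the odd
        case uses j + 1, j and 1.\<close>
      have "W (int k * int n) * W (2 * int n) * W (int n) ^ 2
          = W (int (i+5) * int n) * W (int (i+3) * int n) * W (int (i+2) * int n) ^ 2
          - W (int (i+3) * int n) * W (int (i+1) * int n) * W (int (i+4) * int n) ^ 2"
        using W_ward3[of "int n" "int (i + 2) * int n" "int (i + 4) * int n"] n0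
        by (simp add: 2 i algebra_simps)
      also have "\<dots> = T (i+5) * q ^ ((i+5)^2) * (T (i+3) * q ^ ((i+3)^2)) * (T (i+2) * q ^ ((i+2)^2)) ^ 2
          - T (i+3) * q ^ ((i+3)^2) * (T (i+1) * q ^ ((i+1)^2)) * (T (i+4) * q ^ ((i+4)^2)) ^ 2"
        by (subst (1 2 3 4 5 6) IH) auto
      finally have eq: "W (int k * int n) * (s' * q ^ 4) * q ^ 2 = \<dots>"
        unfolding \<open>W (2 * int n) = s' * W (int n) ^ 4\<close> q_def .
      have e: "k ^ 2 + 6 = (i+5)^2 + (i+3)^2 + (i+2)^2 * 2" "k ^ 2 + 6 = (i+3)^2 + (i+1)^2 + (i+4)^2 * 2"
        by (simp_all add: 2 i power2_eq_square algebra_simps)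
      have "q ^ k ^ 2 * q ^ 6 = q ^ ((i+5)^2) * q ^ ((i+3)^2) * (q ^ ((i+2)^2)) ^ 2"
          "q ^ k ^ 2 * q ^ 6 = q ^ ((i+3)^2) * q ^ ((i+1)^2) * (q ^ ((i+4)^2)) ^ 2"
        unfolding power_add[symmetric] power_mult[symmetric] by (simp only: e(1), simp only: e(2))
      moreover have "T k * s' = T (i+3) * (T (i+5) * T (i+2) ^ 2 - T (i+1) * T (i+4) ^ 2)"
      proof -
        have "T 2 = s'" by (simp add: T_def psi_at_def)
        then have "T k * s' = T j * (T (j + 2) * T (j - 1) ^ 2 - T (j - 2) * T (j + 1) ^ 2)"
          using psi_at_even[OF s'2 \<open>j \<ge> 3\<close>] by (simp only: T_def 2)
        moreover have "j + 2 = i + 5" "j - 1 = i + 2" "j - 2 = i + 1" "j + 1 = i + 4" using i by auto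
        ultimately show ?thesis by (simp only: i)
      qed
      ultimately show ?thesis using q by (rule homogeneous_even[OF eq])
    next
      case (3 j)
      then obtain i where i: "j = i + 2" using le_Suc_ex by (metis add.commute)
      have IH: "W (int l * int n) = T l * q ^ (l ^ 2)" if "l \<in> {i+1..i+4}" for l
        using that less.IH[of l] 3 i by auto
      have "W (int k * int n) * W (int n) * W (int n) ^ 2
          = W (int (i+4) * int n) * W (int (i+2) * int n) * W (int (i+2) * int n) ^ 2
          - W (int (i+3) * int n) * W (int (i+1) * int n) * W (int (i+3) * int n) ^ 2"
        using W_ward3[of "int n" "int (i + 2) * int n" "int (i + 3) * int n"] n0
        by (simp add: 3 i algebra_simps)
      also have "\<dots> = T (i+4) * q ^ ((i+4)^2) * (T (i+2) * q ^ ((i+2)^2)) * (T (i+2) * q ^ ((i+2)^2)) ^ 2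
          - T (i+3) * q ^ ((i+3)^2) * (T (i+1) * q ^ ((i+1)^2)) * (T (i+3) * q ^ ((i+3)^2)) ^ 2"
        by (subst (1 2 3 4 5 6) IH) auto
      finally have eq: "W (int k * int n) * q * q ^ 2 = \<dots>" unfolding q_def .
      have e: "k ^ 2 + 3 = (i+4)^2 + (i+2)^2 * 3" "k ^ 2 + 3 = (i+3)^2 * 3 + (i+1)^2"
        by (simp_all add: 3 i power2_eq_square algebra_simps)
      have "q ^ k ^ 2 * q ^ 3 = q ^ ((i+4)^2) * (q ^ ((i+2)^2)) ^ 3"
          "q ^ k ^ 2 * q ^ 3 = (q ^ ((i+3)^2)) ^ 3 * q ^ ((i+1)^2)"
        unfolding power_add[symmetric] power_mult[symmetric] by (simp only: e(1), simp only: e(2))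
      moreover have "T k = T (i+4) * T (i+2) ^ 3 - T (i+1) * T (i+3) ^ 3"
      proof -
        have "T k = T (j + 2) * T j ^ 3 - T (j - 1) * T (j + 1) ^ 3"
          using psi_at_odd[OF s'2 \<open>j \<ge> 2\<close>] by (simp only: T_def 3)
        moreover have "j + 2 = i + 4" "j - 1 = i + 1" "j + 1 = i + 3" using i by auto
        ultimately show ?thesis by (simp only: i)
      qed
      ultimately show ?thesis using q(1) by (rule homogeneous_odd[OF eq])
    qed
  qed
  then show "psi_at E x s (k * n) = psi_at E x' s' k * psi_at E x s n ^ (k ^ 2)"
    by (simp add: W T_def q_def)
qed

text \<open>The formula for \<open>psi_sq\<close> is the square of \<open>psi_composition\<close>.
  In \<open>theta\<close> the indices m n + 1 and m n - 1 are not multiples of n; Ward's relation at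
  (m n, n) trades their product for that of the indices (m + 1) n and (m - 1) n.\<close>

lemma theta_psi_sq_composition:
  fixes E :: "'a::field wcurve" and n :: nat
  assumes s: "s ^ 2 = poly (wF E) x" and nz: "\<And>n. n > 0 \<Longrightarrow> psi_at E x s n \<noteq> 0"
    and n: "n \<ge> 2" and m: "m \<ge> 1"
  defines "x' \<equiv> poly (theta E n) x / poly (psi_sq E n) x"
  shows "poly (psi_sq E (m * n)) x = poly (psi_sq E n) x ^ (m ^ 2) * poly (psi_sq E m) x'" (is ?psi)
    and "poly (theta E (m * n)) x = poly (psi_sq E n) x ^ (m ^ 2) * poly (theta E m) x'" (is ?theta)
proof -
  define W where "W = psi_int E x s"
  interpret eds W "6 * x ^ 2 + wb2 E * x + wb4 E" "poly (wF E) x" "poly (psit E 3) x"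
    unfolding W_def using s nz by (rule eds_psi)
  have W: "psi_at E x s i = W (int i)" for i by (simp add: W_def psi_int_of_nat)
  have x': "x' = x - psi_at E x s (n + 1) * psi_at E x s (n - 1) / psi_at E x s n ^ 2"
    using nz[of n] n unfolding x'_def psi_at_square[OF s, symmetric]
    by (simp add: psi_at_theta[OF s] field_simps)
  define s' where "s' = psi_at E x s (2 * n) / psi_at E x s n ^ 4"
  have s': "s' ^ 2 = poly (wF E) x'"
    and comp: "psi_at E x s (k * n) = psi_at E x' s' k * psi_at E x s n ^ (k ^ 2)" for k
    using psi_composition[OF s nz n] unfolding x' s'_def by blast+
  show ?psi unfolding psi_at_square[OF s, symmetric] psi_at_square[OF s', symmetric] comp
    by (simp add: power_mult_distrib mult.commute flip: power_mult)
  define q where "q = psi_at E x s n"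
  have q: "q \<noteq> 0" using nz n by (simp add: q_def)
  have "W (int (m * n) + int n) * W (int (m * n) - int n) =
     W (int (m * n) + 1) * W (int (m * n) - 1) * W (int n) ^ 2
     - W (int n + 1) * W (int n - 1) * W (int (m * n)) ^ 2"
    using W_ward[of "int n" "int (m * n)"] m by (simp del: of_nat_mult)
  moreover have idx: "int (m * n) + int n = int ((m + 1) * n)" "int (m * n) - int n = int ((m - 1) * n)"
    "int (m * n) + 1 = int (m * n + 1)" "int (m * n) - 1 = int (m * n - 1)"
    "int n + 1 = int (n + 1)" "int n - 1 = int (n - 1)"
    using m n by (auto simp: algebra_simps of_nat_diff)
  ultimately have ward: "psi_at E x s ((m + 1) * n) * psi_at E x s ((m - 1) * n)
     = psi_at E x s (m * n + 1) * psi_at E x s (m * n - 1) * q ^ 2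
     - psi_at E x s (n + 1) * psi_at E x s (n - 1) * psi_at E x s (m * n) ^ 2"
    unfolding W q_def by (simp only:)
  obtain i where i: "m = i + 1" using m by (metis add.commute le_Suc_ex)
  define r where "r = q ^ m ^ 2"
  have e: "(m + 1) ^ 2 + (m - 1) ^ 2 = m ^ 2 * 2 + 2"
    by (simp add: i power2_eq_square algebra_simps)
  have "psi_at E x s ((m + 1) * n) * psi_at E x s ((m - 1) * n)
      = psi_at E x' s' (m + 1) * psi_at E x' s' (m - 1) * q ^ ((m + 1) ^ 2 + (m - 1) ^ 2)"
    unfolding comp q_def[symmetric] power_add by (simp only: mult_ac)
  also have "\<dots> = psi_at E x' s' (m + 1) * psi_at E x' s' (m - 1) * r ^ 2 * q ^ 2"
    unfolding r_def e power_add power_mult by (simp only: mult_ac)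
  finally have w: "psi_at E x' s' (m + 1) * psi_at E x' s' (m - 1) * r ^ 2 * q ^ 2
     = psi_at E x s (m * n + 1) * psi_at E x s (m * n - 1) * q ^ 2
     - psi_at E x s (n + 1) * psi_at E x s (n - 1) * psi_at E x s (m * n) ^ 2"
    unfolding ward by simp
  have x'q: "x' * q ^ 2 = x * q ^ 2 - psi_at E x s (n + 1) * psi_at E x s (n - 1)"
    using q unfolding x' q_def by (simp add: field_simps)
  have "poly (theta E (m * n)) x * q ^ 2
      = (x * psi_at E x s (m * n) ^ 2 - psi_at E x s (m * n + 1) * psi_at E x s (m * n - 1)) * q ^ 2"
    using m n by (simp add: psi_at_theta[OF s])
  also have "\<dots> = (x' * psi_at E x s (m * n) ^ 2
         - psi_at E x' s' (m + 1) * psi_at E x' s' (m - 1) * r ^ 2) * q ^ 2"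
    using w x'q by Groebner_Basis.algebra
  also have "\<dots> = r ^ 2 * poly (theta E m) x' * q ^ 2"
    unfolding comp q_def[symmetric] r_def[symmetric] psi_at_theta[OF s' m] by Groebner_Basis.algebra
  finally show ?theta using q
    unfolding psi_at_square[OF s, symmetric] q_def[symmetric] r_def
    by (simp add: mult.commute flip: power_mult)
qed

section \<open>Leading terms of the division polynomials in arbitrary characteristic\<close>

subsection \<open>Degrees and leading coefficients\<close>

text \<open>Only an upper bound on the degree is recorded, since \<open>c\<close> may be 0 in
  positive characteristic; this keeps the notion stable under products over any commutative
  ring.\<close>

definition top_coeff :: "'a::comm_ring_1 poly \<Rightarrow> nat \<Rightarrow> 'a \<Rightarrow> bool" where
  "top_coeff p d c \<longleftrightarrow> degree p \<le> d \<and> coeff p d = c"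

lemma top_coeff_one: "top_coeff 1 0 1"
  by (simp add: top_coeff_def)

lemma top_coeff_mult:
  assumes "top_coeff p d a" "top_coeff q e b"
  shows "top_coeff (p * q) (d + e) (a * b)"
proof -
  have "coeff (p * q) (d + e) = (\<Sum>i\<le>d + e. coeff p i * coeff q (d + e - i))"
    by (rule coeff_mult)
  also have "\<dots> = (\<Sum>i\<in>{d}. coeff p i * coeff q (d + e - i))"
  proof (rule sum.mono_neutral_right)
    show "\<forall>i\<in>{..d + e} - {d}. coeff p i * coeff q (d + e - i) = 0"
    proof
      fix i assume "i \<in> {..d + e} - {d}"
      then have "i > d \<or> d + e - i > e" by auto
      then have "coeff p i = 0 \<or> coeff q (d + e - i) = 0"
        using assms by (auto simp: top_coeff_def intro: coeff_eq_0)
      then show "coeff p i * coeff q (d + e - i) = 0" by auto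
    qed
  qed auto
  finally show ?thesis
    using assms degree_mult_le[of p q] by (auto simp: top_coeff_def)
qed

lemma top_coeff_power: "top_coeff p d a \<Longrightarrow> top_coeff (p ^ n) (n * d) (a ^ n)"
  by (induction n) (auto intro: top_coeff_mult top_coeff_one)

lemma top_coeff_diff: "top_coeff p d a \<Longrightarrow> top_coeff q d b \<Longrightarrow> top_coeff (p - q) d (a - b)"
  by (auto simp: top_coeff_def intro: degree_diff_le)

lemma top_coeff_cong: "top_coeff p d a \<Longrightarrow> d = d' \<Longrightarrow> a = a' \<Longrightarrow> top_coeff p d' a'"
  by simp

lemmas top_coeff_intros = top_coeff_mult top_coeff_power top_coeff_one

lemma top_coeff_wF: "top_coeff (wF E) 3 4"
  by (auto simp: top_coeff_def wF_def numeral_eq_Suc)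

text \<open>In terms of n: degree (n^2 - 1)/2 and coefficient n for odd n, degree (n^2 - 4)/2 and
  coefficient n/2 for even n. The parameter \<open>i\<close> avoids these divisions. The recursion
  depends on n modulo 4, whence four inductive cases.\<close>

lemma top_coeff_psit_aux:
  fixes E :: "'a::comm_ring_1 wcurve"
  shows "(\<forall>i. n = 2 * i + 1 \<longrightarrow> top_coeff (psit E n) (2 * i ^ 2 + 2 * i) (2 * of_nat i + 1)) \<and>
         (\<forall>i. n = 2 * i + 2 \<longrightarrow> top_coeff (psit E n) (2 * i ^ 2 + 4 * i) (of_nat i + 1))"
proof (induction n rule: less_induct)
  case (less n)
  have odd: "top_coeff (psit E (2 * i + 1)) (2 * i ^ 2 + 2 * i) (2 * of_nat i + 1)"
    if "2 * i + 1 < n" for i using less.IH[OF that] by blast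
  have even: "top_coeff (psit E (2 * i + 2)) (2 * i ^ 2 + 4 * i) (of_nat i + 1)"
    if "2 * i + 2 < n" for i using less.IH[OF that] by blast
  consider "n \<in> {0,1,2,3,4}" | i where "n = 2 * (2 * i + 4)" | i where "n = 2 * (2 * i + 3)"
    | i where "n = 2 * (2 * i + 2) + 1" | i where "n = 2 * (2 * i + 3) + 1"
  proof -
    assume that: "n \<in> {0,1,2,3,4} \<Longrightarrow> thesis" "\<And>i. n = 2 * (2 * i + 4) \<Longrightarrow> thesis"
      "\<And>i. n = 2 * (2 * i + 3) \<Longrightarrow> thesis" "\<And>i. n = 2 * (2 * i + 2) + 1 \<Longrightarrow> thesis"
      "\<And>i. n = 2 * (2 * i + 3) + 1 \<Longrightarrow> thesis"
    show thesis
    proof (cases "n \<le> 4")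
      case True
      then have "n \<in> {0,1,2,3,4}" by auto
      then show thesis by (rule that(1))
    next
      case False
      define q where "q = n div 4"
      have "n = 4 * q + n mod 4" by (simp add: q_def)
      moreover have "n mod 4 < 4" by simp
      ultimately consider "n = 4 * q" | "n = 4 * q + 1" | "n = 4 * q + 2" | "n = 4 * q + 3"
        by linarith
      then show thesis
      proof cases
        case 1
        then have "n = 2 * (2 * (q - 2) + 4)" using False by arith
        then show thesis by (rule that(2))
      next
        case 2
        then have "n = 2 * (2 * (q - 1) + 2) + 1" using False by arith
        then show thesis by (rule that(4))
      next
        case 3
        then have "n = 2 * (2 * (q - 1) + 3)" using False by arith
        then show thesis by (rule that(3))
      next
        case 4
        then have "n = 2 * (2 * (q - 1) + 3) + 1" using False by arith
        then show thesis by (rule that(5))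
      qed
    qed
  qed
  then show ?case
  proof cases
    case 1
    have c: "top_coeff (psit E 1) 0 1" "top_coeff (psit E 2) 0 1" "top_coeff (psit E 3) 4 3"
      "top_coeff (psit E 4) 6 2"
      unfolding psit_base top_coeff_def by (simp_all add: numeral_eq_Suc)
    show ?thesis
    proof (intro conjI allI impI)
      fix i assume n: "n = 2 * i + 1"
      then have "i = 0 \<and> n = 1 \<or> i = 1 \<and> n = 3"
        using 1 unfolding insert_iff empty_iff by presburger
      then show "top_coeff (psit E n) (2 * i ^ 2 + 2 * i) (2 * of_nat i + 1)"
        using c by (elim disjE conjE; simp only:; simp)
    next
      fix i assume n: "n = 2 * i + 2"
      then have "i = 0 \<and> n = 2 \<or> i = 1 \<and> n = 4"
        using 1 unfolding insert_iff empty_iff by presburger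
      then show "top_coeff (psit E n) (2 * i ^ 2 + 4 * i) (of_nat i + 1)"
        using c by (elim disjE conjE; simp only:; simp)
    qed
  next
    case (2 i)
    have idx: "2 * i + 4 - 1 = 2 * (i + 1) + 1" "2 * i + 4 + 1 = 2 * (i + 2) + 1"
      "2 * i + 4 - 2 = 2 * i + 2" "2 * i + 4 + 2 = 2 * (i + 2) + 2" "2 * i + 4 = 2 * (i + 1) + 2"
      by simp_all
    have eq: "psit E n = psit E (2 * (i + 1) + 2)
      * (psit E (2 * (i + 2) + 2) * psit E (2 * (i + 1) + 1) ^ 2
         - psit E (2 * i + 2) * psit E (2 * (i + 2) + 1) ^ 2)"
      using psit_even[of "2 * i + 4" E] unfolding 2 idx by simp
    have t: "top_coeff (psit E (2 * (i + 2) + 2) * psit E (2 * (i + 1) + 1) ^ 2)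
       (2 * (i+2)^2 + 4 * (i+2) + 2 * (2 * (i+1)^2 + 2 * (i+1)))
       ((of_nat (i + 2) + 1) * (2 * of_nat (i + 1) + 1) ^ 2)"
      "top_coeff (psit E (2 * i + 2) * psit E (2 * (i + 2) + 1) ^ 2)
       (2 * i^2 + 4 * i + 2 * (2 * (i+2)^2 + 2 * (i+2)))
       ((of_nat i + 1) * (2 * of_nat (i + 2) + 1) ^ 2)"
      "top_coeff (psit E (2 * (i + 1) + 2)) (2 * (i+1)^2 + 4 * (i+1)) (of_nat (i + 1) + 1)"
      by (intro top_coeff_intros odd even; simp add: 2)+
    \<comment> \<open>Both products have the same formal degree, and their cubic leading
      coefficients in \<open>i\<close> differ only by the constant 2.\<close>
    have "top_coeff (psit E (2 * (i + 2) + 2) * psit E (2 * (i + 1) + 1) ^ 2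
         - psit E (2 * i + 2) * psit E (2 * (i + 2) + 1) ^ 2) (6 * i ^ 2 + 24 * i + 24) 2"
      by (rule top_coeff_diff[OF t(1), THEN top_coeff_cong], rule top_coeff_cong[OF t(2)])
         (simp_all add: power2_eq_square algebra_simps)
    from top_coeff_mult[OF t(3) this]
    have "top_coeff (psit E n) (2 * (2 * i + 3) ^ 2 + 4 * (2 * i + 3)) (of_nat (2 * i + 3) + 1)"
      unfolding eq by (rule top_coeff_cong) (simp_all add: power2_eq_square algebra_simps)
    moreover have "l = 2 * i + 3" if "n = 2 * l + 2" for l using that 2 by simp
    moreover have "n \<noteq> 2 * l + 1" for l using 2 by presburger
    ultimately show ?thesis by (simp only:) blast
  next
    case (3 i)
    have idx: "2 * i + 3 - 1 = 2 * i + 2" "2 * i + 3 + 1 = 2 * (i + 1) + 2"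
      "2 * i + 3 - 2 = 2 * i + 1" "2 * i + 3 + 2 = 2 * (i + 2) + 1" "2 * i + 3 = 2 * (i + 1) + 1"
      by simp_all
    have eq: "psit E n = psit E (2 * (i + 1) + 1)
      * (psit E (2 * (i + 2) + 1) * psit E (2 * i + 2) ^ 2
         - psit E (2 * i + 1) * psit E (2 * (i + 1) + 2) ^ 2)"
      using psit_even[of "2 * i + 3" E] unfolding 3 idx by simp
    have t: "top_coeff (psit E (2 * (i + 2) + 1) * psit E (2 * i + 2) ^ 2)
       (2 * (i+2)^2 + 2 * (i+2) + 2 * (2 * i^2 + 4 * i))
       ((2 * of_nat (i + 2) + 1) * (of_nat i + 1) ^ 2)"
      "top_coeff (psit E (2 * i + 1) * psit E (2 * (i + 1) + 2) ^ 2)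
       (2 * i^2 + 2 * i + 2 * (2 * (i+1)^2 + 4 * (i+1)))
       ((2 * of_nat i + 1) * (of_nat (i + 1) + 1) ^ 2)"
      "top_coeff (psit E (2 * (i + 1) + 1)) (2 * (i+1)^2 + 2 * (i+1)) (2 * of_nat (i + 1) + 1)"
      by (intro top_coeff_intros odd even; simp add: 3)+
    have "top_coeff (psit E (2 * (i + 2) + 1) * psit E (2 * i + 2) ^ 2
         - psit E (2 * i + 1) * psit E (2 * (i + 1) + 2) ^ 2) (6 * i ^ 2 + 18 * i + 12) 1"
      by (rule top_coeff_diff[OF t(1), THEN top_coeff_cong], rule top_coeff_cong[OF t(2)])
         (simp_all add: power2_eq_square algebra_simps)
    from top_coeff_mult[OF t(3) this]
    have "top_coeff (psit E n) (2 * (2 * i + 2) ^ 2 + 4 * (2 * i + 2)) (of_nat (2 * i + 2) + 1)"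
      unfolding eq by (rule top_coeff_cong) (simp_all add: power2_eq_square algebra_simps)
    moreover have "l = 2 * i + 2" if "n = 2 * l + 2" for l using that 3 by simp
    moreover have "n \<noteq> 2 * l + 1" for l using 3 by presburger
    ultimately show ?thesis by (simp only:) blast
  next
    case (4 i)
    have idx: "2 * i + 2 - 1 = 2 * i + 1" "2 * i + 2 + 1 = 2 * (i + 1) + 1"
      "2 * i + 2 + 2 = 2 * (i + 1) + 2" by simp_all
    have eq: "psit E n = wF E ^ 2 * psit E (2 * (i + 1) + 2) * psit E (2 * i + 2) ^ 3
        - psit E (2 * i + 1) * psit E (2 * (i + 1) + 1) ^ 3"
      using psit_odd[of "2 * i + 2" E] unfolding 4 idx by simp
    have t: "top_coeff (wF E ^ 2 * psit E (2 * (i + 1) + 2) * psit E (2 * i + 2) ^ 3)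
       (2 * 3 + (2 * (i+1)^2 + 4 * (i+1)) + 3 * (2 * i^2 + 4 * i))
       (4 ^ 2 * (of_nat (i + 1) + 1) * (of_nat i + 1) ^ 3)"
      "top_coeff (psit E (2 * i + 1) * psit E (2 * (i + 1) + 1) ^ 3)
       (2 * i^2 + 2 * i + 3 * (2 * (i+1)^2 + 2 * (i+1)))
       ((2 * of_nat i + 1) * (2 * of_nat (i + 1) + 1) ^ 3)"
      by (intro top_coeff_intros top_coeff_wF odd even; simp add: 4)+
    have "top_coeff (psit E n) (2 * (2 * i + 2) ^ 2 + 2 * (2 * i + 2)) (2 * of_nat (2 * i + 2) + 1)"
      unfolding eq
      by (rule top_coeff_cong, rule top_coeff_diff[OF t(1)], rule top_coeff_cong[OF t(2)])
         (simp_all add: power2_eq_square power3_eq_cube algebra_simps)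
    moreover have "l = 2 * i + 2" if "n = 2 * l + 1" for l using that 4 by simp
    moreover have "n \<noteq> 2 * l + 2" for l using 4 by presburger
    ultimately show ?thesis by (simp only:) blast
  next
    case (5 i)
    have idx: "2 * i + 3 - 1 = 2 * i + 2" "2 * i + 3 + 1 = 2 * (i + 1) + 2"
      "2 * i + 3 + 2 = 2 * (i + 2) + 1" "2 * i + 3 = 2 * (i + 1) + 1" by simp_all
    have eq: "psit E n = psit E (2 * (i + 2) + 1) * psit E (2 * (i + 1) + 1) ^ 3
        - wF E ^ 2 * psit E (2 * i + 2) * psit E (2 * (i + 1) + 2) ^ 3"
      using psit_odd[of "2 * i + 3" E] unfolding 5 idx by simp
    have t: "top_coeff (psit E (2 * (i + 2) + 1) * psit E (2 * (i + 1) + 1) ^ 3)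
       (2 * (i+2)^2 + 2 * (i+2) + 3 * (2 * (i+1)^2 + 2 * (i+1)))
       ((2 * of_nat (i + 2) + 1) * (2 * of_nat (i + 1) + 1) ^ 3)"
      "top_coeff (wF E ^ 2 * psit E (2 * i + 2) * psit E (2 * (i + 1) + 2) ^ 3)
       (2 * 3 + (2 * i^2 + 4 * i) + 3 * (2 * (i+1)^2 + 4 * (i+1)))
       (4 ^ 2 * (of_nat i + 1) * (of_nat (i + 1) + 1) ^ 3)"
      by (intro top_coeff_intros top_coeff_wF odd even; simp add: 5)+
    have "top_coeff (psit E n) (2 * (2 * i + 3) ^ 2 + 2 * (2 * i + 3)) (2 * of_nat (2 * i + 3) + 1)"
      unfolding eq
      by (rule top_coeff_cong, rule top_coeff_diff[OF t(1)], rule top_coeff_cong[OF t(2)])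
         (simp_all add: power2_eq_square power3_eq_cube algebra_simps)
    moreover have "l = 2 * i + 3" if "n = 2 * l + 1" for l using that 5 by simp
    moreover have "n \<noteq> 2 * l + 2" for l using 5 by presburger
    ultimately show ?thesis by (simp only:) blast
  qed
qed

lemma top_coeff_psit_odd: "top_coeff (psit E (2 * i + 1)) (2 * i ^ 2 + 2 * i) (2 * of_nat i + 1)"
  and top_coeff_psit_even: "top_coeff (psit E (2 * i + 2)) (2 * i ^ 2 + 4 * i) (of_nat i + 1)"
  using top_coeff_psit_aux by blast+

lemma top_coeff_psi_sq:
  assumes "n > 0"
  shows "top_coeff (psi_sq E n) (n ^ 2 - 1) (of_nat n ^ 2)"
proof (cases "even n")
  case True
  with assms obtain i where i: "n = 2 * i + 2"
    by (metis Suc_pred add_Suc_right evenE mult_2 mult_Suc_right nat_0_less_mult_iff add_2_eq_Suc' add.commute)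
  have "psi_sq E n = wF E * psit E (2 * i + 2) ^ 2" by (simp add: psi_sq_def i)
  moreover have "top_coeff \<dots> (3 + 2 * (2 * i ^ 2 + 4 * i)) (4 * (of_nat i + 1) ^ 2)"
    by (intro top_coeff_intros top_coeff_wF top_coeff_psit_even)
  ultimately have "top_coeff (psi_sq E n) (3 + 2 * (2 * i ^ 2 + 4 * i)) (4 * (of_nat i + 1) ^ 2)"
    by (simp only:)
  then show ?thesis
    by (rule top_coeff_cong) (simp_all add: i power2_eq_square algebra_simps)
next
  case False
  then obtain i where i: "n = 2 * i + 1" by (rule oddE)
  have "psi_sq E n = psit E (2 * i + 1) ^ 2" by (simp add: psi_sq_def i)
  moreover have "top_coeff \<dots> (2 * (2 * i ^ 2 + 2 * i)) ((2 * of_nat i + 1) ^ 2)"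
    by (intro top_coeff_intros top_coeff_psit_odd)
  ultimately have "top_coeff (psi_sq E n) (2 * (2 * i ^ 2 + 2 * i)) ((2 * of_nat i + 1) ^ 2)"
    by (simp only:)
  then show ?thesis
    by (rule top_coeff_cong) (simp_all add: i power2_eq_square algebra_simps)
qed

text \<open>The coefficients n^2 and n^2 - 1 of the two terms differ by 1, so \<open>theta\<close>
  is monic in every characteristic.\<close>

lemma top_coeff_theta:
  fixes E :: "'a::comm_ring_1 wcurve"
  assumes "n > 0"
  shows "top_coeff (theta E n) (n ^ 2) 1"
proof -
  have X: "top_coeff ([:0, 1:] * psi_sq E n) (1 + (n ^ 2 - 1)) (1 * of_nat n ^ 2)"
    by (intro top_coeff_intros top_coeff_psi_sq assms) (simp add: top_coeff_def)
  have n: "1 + (n ^ 2 - 1) = n ^ 2" using assms by simp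
  have Y: "top_coeff ((if odd n then wF E else 1) * psit E (n + 1) * psit E (n - 1)) (n ^ 2) (of_nat n ^ 2 - 1)"
  proof (cases "even n")
    case True
    with assms obtain i where i: "n = 2 * i + 2"
      by (metis Suc_pred add_Suc_right evenE mult_2 mult_Suc_right nat_0_less_mult_iff add_2_eq_Suc' add.commute)
    have "top_coeff (psit E (2 * (i + 1) + 1) * psit E (2 * i + 1))
      (2 * (i+1) ^ 2 + 2 * (i+1) + (2 * i ^ 2 + 2 * i)) ((2 * of_nat (i + 1) + 1) * (2 * of_nat i + 1))"
      by (intro top_coeff_intros top_coeff_psit_odd)
    then have "top_coeff (psit E (2 * (i + 1) + 1) * psit E (2 * i + 1)) (n ^ 2) (of_nat n ^ 2 - 1)"
      by (rule top_coeff_cong) (simp_all add: i power2_eq_square algebra_simps)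
    moreover have "n + 1 = 2 * (i + 1) + 1" "n - 1 = 2 * i + 1" by (simp_all add: i)
    ultimately show ?thesis using True by simp
  next
    case False
    then obtain l where l: "n = 2 * l + 1" by (rule oddE)
    show ?thesis
    proof (cases l)
      case 0
      then show ?thesis by (simp add: l top_coeff_def)
    next
      case (Suc i)
      have "top_coeff (wF E * psit E (2 * (i + 1) + 2) * psit E (2 * i + 2))
        (3 + (2 * (i+1) ^ 2 + 4 * (i+1)) + (2 * i ^ 2 + 4 * i)) (4 * (of_nat (i + 1) + 1) * (of_nat i + 1))"
        by (intro top_coeff_intros top_coeff_psit_even top_coeff_wF)
      then have "top_coeff (wF E * psit E (2 * (i + 1) + 2) * psit E (2 * i + 2)) (n ^ 2) (of_nat n ^ 2 - 1)"
        by (rule top_coeff_cong) (simp_all add: l Suc power2_eq_square algebra_simps)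
      moreover have "n + 1 = 2 * (i + 1) + 2" "n - 1 = 2 * i + 2" by (simp_all add: l Suc)
      ultimately show ?thesis using False by simp
    qed
  qed
  show ?thesis unfolding theta_def
    by (rule top_coeff_cong[OF top_coeff_diff[OF X[unfolded n] Y]]) simp_all
qed

section \<open>Transfer of polynomial identities along ring homomorphisms\<close>

subsection \<open>Specialisation of the generic curve\<close>

locale ring_map =
  fixes h :: "'a::comm_ring_1 \<Rightarrow> 'b::comm_ring_1"
  assumes add: "h (x + y) = h x + h y" and mult: "h (x * y) = h x * h y" and one: "h 1 = 1"
begin

lemma zero: "h 0 = 0" using add[of 0 0] by simp
lemma minus: "h (- x) = - h x" using add[of x "- x"] by (simp add: zero eq_neg_iff_add_eq_0 add.commute)
lemma diff: "h (x - y) = h x - h y" using add[of x "- y"] by (simp add: minus)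
lemma power: "h (x ^ n) = h x ^ n" by (induction n) (simp_all add: mult one)
lemma sum: "h (sum f A) = (\<Sum>x\<in>A. h (f x))"
  by (induction A rule: infinite_finite_induct) (simp_all add: zero add)
lemma of_nat: "h (of_nat n) = of_nat n" by (induction n) (simp_all add: zero add one)
lemma numeral: "h (numeral n) = numeral n" using of_nat[of "numeral n"] by simp

lemmas simps = zero one add minus diff mult power numeral

lemma map_poly_pCons: "map_poly h (pCons a p) = pCons (h a) (map_poly h p)"
  by (rule Polynomial.map_poly_pCons) (rule zero)

lemma coeff_map_poly: "coeff (map_poly h p) i = h (coeff p i)"
  by (rule Polynomial.coeff_map_poly) (rule zero)

lemma ring_map_map_poly: "ring_map (map_poly h)"
proof
  fix p q :: "'a poly"
  show "map_poly h (p + q) = map_poly h p + map_poly h q"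
    by (rule poly_eqI) (simp add: coeff_map_poly add)
  show "map_poly h (p * q) = map_poly h p * map_poly h q"
    by (rule poly_eqI) (simp add: coeff_map_poly coeff_mult sum mult)
  show "map_poly h 1 = (1 :: 'b poly)" by (simp add: one)
qed

lemma ring_map_eval: "ring_map (\<lambda>p. poly (map_poly h p) a)"
proof -
  interpret p: ring_map "map_poly h" by (rule ring_map_map_poly)
  show ?thesis by standard (simp_all add: p.simps)
qed

end

text \<open>The N-homogenisation of \<open>p\<close> at \<open>(U, Z)\<close>: formally \<open>Z ^ N * p (U / Z)\<close> for \<open>degree p \<le> N\<close>.\<close>

definition hom_subst :: "nat \<Rightarrow> 'a::comm_ring_1 poly \<Rightarrow> 'a poly \<Rightarrow> 'a poly \<Rightarrow> 'a poly" where
  "hom_subst N p U Z = (\<Sum>i\<le>N. [:coeff p i:] * U ^ i * Z ^ (N - i))"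

lemma hom_subst_diff: "hom_subst N (p - q) U Z = hom_subst N p U Z - hom_subst N q U Z"
proof -
  have "[:coeff p i - coeff q i:] = [:coeff p i:] - [:coeff q i:]" for i by simp
  then show ?thesis unfolding hom_subst_def coeff_diff by (simp only: left_diff_distrib sum_subtractf)
qed

lemma hom_subst_const: "hom_subst N ([:c:] * p) U Z = [:c:] * hom_subst N p U Z"
proof -
  have "[:coeff ([:c:] * p) i:] = [:c:] * [:coeff p i:]" for i by simp
  then show ?thesis unfolding hom_subst_def sum_distrib_left by (simp only: mult.assoc)
qed

lemma (in ring_map) map_poly_hom_subst:
  "map_poly h (hom_subst N p U Z) = hom_subst N (map_poly h p) (map_poly h U) (map_poly h Z)"
proof -
  interpret p: ring_map "map_poly h" by (rule ring_map_map_poly)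
  show ?thesis
    by (simp add: hom_subst_def p.sum p.mult p.power map_poly_pCons coeff_map_poly del: mult_pCons_left)
qed

text \<open>The quotient \<open>x\<close> enters through the product \<open>x * z\<close>, so no
  division is required in the target ring.\<close>

lemma (in ring_map) eval_hom_subst:
  assumes "degree p \<le> N" and "poly (map_poly h Z) a = z" and "poly (map_poly h U) a = x * z"
  shows "poly (map_poly h (hom_subst N p U Z)) a = z ^ N * poly (map_poly h p) x"
proof -
  interpret e: ring_map "\<lambda>p. poly (map_poly h p) a" by (rule ring_map_eval)
  have "degree (map_poly h p) \<le> N"
    using assms(1) by (intro degree_le) (simp add: coeff_map_poly coeff_eq_0 zero)
  then have "poly (map_poly h p) x = (\<Sum>i\<le>N. h (coeff p i) * x ^ i)"
    unfolding poly_altdef coeff_map_poly[symmetric]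
    by (intro sum.mono_neutral_left) (auto simp: coeff_eq_0)
  moreover have "poly (map_poly h (hom_subst N p U Z)) a
      = (\<Sum>i\<le>N. h (coeff p i) * (x * z) ^ i * z ^ (N - i))"
    unfolding hom_subst_def e.sum e.mult e.power assms(2,3) by (simp add: map_poly_pCons)
  moreover have "(x * z) ^ i * z ^ (N - i) = z ^ N * x ^ i" if "i \<le> N" for i
    using that by (simp add: power_mult_distrib mult_ac flip: power_add)
  ultimately show ?thesis
    by (simp add: sum_distrib_left mult_ac)
qed

context ring_map
begin

lemma wF_map: "wF (map_wcurve h E) = map_poly h (wF E)"
  and wb_map: "wb2 (map_wcurve h E) = h (wb2 E)" "wb4 (map_wcurve h E) = h (wb4 E)"
    "wb6 (map_wcurve h E) = h (wb6 E)" "wb8 (map_wcurve h E) = h (wb8 E)"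
  by (cases E; simp add: wF_def wb2_def wb4_def wb6_def wb8_def simps map_poly_pCons)+

lemma psit_map: "psit (map_wcurve h E) n = map_poly h (psit E n)"
proof (induction n rule: less_induct)
  case (less n)
  interpret p: ring_map "map_poly h" by (rule ring_map_map_poly)
  consider "n \<in> {0,1,2,3,4}" | j where "n = 2 * j" "j \<ge> 3" | j where "n = 2 * j + 1" "j \<ge> 2"
  proof -
    have "n \<in> {0,1,2,3,4} \<or> n \<ge> 5" by auto
    then show thesis using that by (cases "even n") (auto elim!: evenE oddE)
  qed
  then show ?case
  proof cases
    case 1
    then show ?thesis
      by (elim insertE emptyE) (simp_all add: map_poly_pCons wb_map simps)
  next
    case (2 j)
    then show ?thesis
      using less.IH[of j] less.IH[of "j + 2"] less.IH[of "j - 1"] less.IH[of "j + 1"] less.IH[of "j - 2"]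
      by (simp add: psit_even p.simps)
  next
    case (3 j)
    then show ?thesis
      using less.IH[of j] less.IH[of "j + 2"] less.IH[of "j - 1"] less.IH[of "j + 1"]
      by (simp only: psit_odd p.simps wF_map if_distrib[of "map_poly h"])
  qed
qed

lemma psi_sq_map: "psi_sq (map_wcurve h E) n = map_poly h (psi_sq E n)"
  and theta_map: "theta (map_wcurve h E) n = map_poly h (theta E n)"
proof -
  interpret p: ring_map "map_poly h" by (rule ring_map_map_poly)
  have "map_poly h [:0, 1:] = [:0, 1:]" by (simp add: map_poly_pCons simps)
  moreover show "psi_sq (map_wcurve h E) n = map_poly h (psi_sq E n)"
    by (simp add: psi_sq_def psit_map wF_map p.simps)
  ultimately show "theta (map_wcurve h E) n = map_poly h (theta E n)"
    unfolding theta_def psit_map wF_map by (simp only: p.simps if_distrib[of "map_poly h"])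
qed

end

section \<open>The composition law over Z[a1, a2, a3, a4, a6] and its specialisations\<close>

type_synonym coeff_ring = "int poly poly poly poly poly"

text \<open>The universal Weierstrass curve: a1 is the outermost variable of
  \<open>coeff_ring\<close>, a6 the innermost.\<close>

definition gcurve :: "coeff_ring wcurve" where
  "gcurve = WCurve [:0, 1:] [:[:0, 1:]:] [:[:[:0, 1:]:]:] [:[:[:[:0, 1:]:]:]:] [:[:[:[:[:0, 1:]:]:]:]:]"

text \<open>The variables are evaluated one at a time from a6 outwards to a1, each evaluation
  serving as coefficient map of the next.\<close>

lemma gcurve_specialise: "\<exists>h. ring_map h \<and> map_wcurve h gcurve = (E :: 'a::comm_ring_1 wcurve)"
proof -
  obtain a1 a2 a3 a4 a6 where E: "E = WCurve a1 a2 a3 a4 a6" by (cases E)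
  interpret h0: ring_map "of_int :: int \<Rightarrow> 'a" by standard simp_all
  interpret h1: ring_map "\<lambda>p. poly (map_poly (of_int :: int \<Rightarrow> 'a) p) a6" by (rule h0.ring_map_eval)
  define k2 where "k2 = (\<lambda>q. poly (map_poly (\<lambda>p. poly (map_poly (of_int :: int \<Rightarrow> 'a) p) a6) q) a4)"
  interpret h2: ring_map k2 unfolding k2_def by (rule h1.ring_map_eval)
  define k3 where "k3 = (\<lambda>q. poly (map_poly k2 q) a3)"
  interpret h3: ring_map k3 unfolding k3_def by (rule h2.ring_map_eval)
  define k4 where "k4 = (\<lambda>q. poly (map_poly k3 q) a2)"
  interpret h4: ring_map k4 unfolding k4_def by (rule h3.ring_map_eval)
  define k5 where "k5 = (\<lambda>q. poly (map_poly k4 q) a1)"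
  interpret h5: ring_map k5 unfolding k5_def by (rule h4.ring_map_eval)
  have 1: "k2 [:p:] = poly (map_poly of_int p) a6" "k2 [:0,1:] = a4" for p
    by (simp_all add: k2_def h1.map_poly_pCons h1.simps h1.one)
  have 2: "k3 [:q:] = k2 q" "k3 [:0,1:] = a3" for q
    by (simp_all add: k3_def h2.map_poly_pCons h2.simps)
  have 3: "k4 [:q:] = k3 q" "k4 [:0,1:] = a2" for q
    by (simp_all add: k4_def h3.map_poly_pCons h3.simps)
  have 4: "k5 [:q:] = k4 q" "k5 [:0,1:] = a1" for q
    by (simp_all add: k5_def h4.map_poly_pCons h4.simps)
  have "map_wcurve k5 gcurve = E"
    unfolding gcurve_def E wcurve.map 4 3 2 1 by (simp add: h0.map_poly_pCons)
  then show ?thesis using h5.ring_map_axioms by blast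
qed

text \<open>The leading coefficient is a positive integer and \<open>coeff_ring\<close> has
  characteristic 0.\<close>

lemma psit_gcurve_nz:
  assumes "n > 0"
  shows "psit gcurve n \<noteq> 0"
proof (cases "even n")
  case True
  with assms obtain i where i: "n = 2 * i + 2"
    by (metis Suc_pred add_Suc_right evenE mult_2 mult_Suc_right nat_0_less_mult_iff add_2_eq_Suc' add.commute)
  have "(of_nat i + 1 :: coeff_ring) \<noteq> 0"
    using of_nat_neq_0[of i, where 'a = coeff_ring] by (simp only: of_nat_Suc add.commute) simp
  then show ?thesis using top_coeff_psit_even[of gcurve i] i by (auto simp: top_coeff_def)
next
  case False
  then obtain i where i: "n = 2 * i + 1" by (rule oddE)
  have "(2 * of_nat i + 1 :: coeff_ring) \<noteq> 0"
    using of_nat_neq_0[of "2 * i", where 'a = coeff_ring] by (simp add: add.commute)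
  then show ?thesis using top_coeff_psit_odd[of gcurve i] i by (auto simp: top_coeff_def)
qed

text \<open>Evaluation at the generic abscissa, the polynomial variable itself, embeds the
  polynomials over \<open>coeff_ring\<close> into a field, so equal values give equal polynomials.
  The algebraic closure provides the square root \<open>s\<close> of \<open>wF\<close>.\<close>

lemma composition_gcurve:
  assumes n: "n \<ge> 2" and m: "m \<ge> 1"
  shows "psi_sq gcurve (m * n) = hom_subst (m ^ 2) (psi_sq gcurve m) (theta gcurve n) (psi_sq gcurve n)"
    and "theta gcurve (m * n) = hom_subst (m ^ 2) (theta gcurve m) (theta gcurve n) (psi_sq gcurve n)"
proof -
  define iota :: "coeff_ring \<Rightarrow> coeff_ring poly fract alg_closure"
    where "iota a = to_ac (to_fract [:a:])" for a
  interpret i: ring_map iota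
    by standard (simp_all add: iota_def flip: to_fract_mult to_ac_mult to_fract_add to_ac_add one_pCons)
  define x where "x = to_ac (to_fract [:0, 1 :: coeff_ring:])"
  have eval: "poly (map_poly iota p) x = to_ac (to_fract p)" for p
  proof (induction p)
    case 0
    then show ?case by simp
  next
    case (pCons a p)
    have "pCons a p = [:a:] + [:0, 1:] * p" by simp
    then have "to_ac (to_fract (pCons a p)) = iota a + x * to_ac (to_fract p)"
      unfolding iota_def x_def by (simp only: to_fract_add to_ac_add to_fract_mult to_ac_mult)
    then show ?case by (simp add: i.map_poly_pCons pCons.IH)
  qed
  define E where "E = map_wcurve iota gcurve"
  obtain s where s: "s ^ 2 = poly (wF E) x" using nth_root_exists[of 2] by auto
  have "s \<noteq> 0"
  proof
    assume "s = 0"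
    then have "wF gcurve = 0" using s by (simp add: E_def i.wF_map eval)
    then show False by (simp add: wF_def)
  qed
  then have nz: "psi_at E x s k \<noteq> 0" if "k > 0" for k
    using psit_gcurve_nz[OF that] by (simp add: psi_at_def E_def i.psit_map eval)
  have psi: "poly (psi_sq E k) x = to_ac (to_fract (psi_sq gcurve k))"
    and theta: "poly (theta E k) x = to_ac (to_fract (theta gcurve k))" for k
    by (simp_all add: E_def i.psi_sq_map i.theta_map eval)
  have "poly (psi_sq E n) x \<noteq> 0"
    using nz[of n] n by (simp flip: psi_at_square[OF s])
  then have subst: "to_ac (to_fract (hom_subst (m ^ 2) p (theta gcurve n) (psi_sq gcurve n)))
      = poly (psi_sq E n) x ^ (m ^ 2) * poly (map_poly iota p) (poly (theta E n) x / poly (psi_sq E n) x)"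
    if "degree p \<le> m ^ 2" for p
    using i.eval_hom_subst[OF that, of "psi_sq gcurve n" x "poly (psi_sq E n) x" "theta gcurve n"
        "poly (theta E n) x / poly (psi_sq E n) x"]
    unfolding eval psi theta by simp
  have psiE: "psi_sq E k = map_poly iota (psi_sq gcurve k)"
    and thetaE: "theta E k = map_poly iota (theta gcurve k)" for k
    by (simp_all add: E_def i.psi_sq_map i.theta_map)
  note comp = theta_psi_sq_composition[OF s nz n m]
  have d: "degree (psi_sq gcurve m) \<le> m ^ 2"
    using top_coeff_psi_sq[of m gcurve] m by (auto simp: top_coeff_def)
  have "to_ac (to_fract (psi_sq gcurve (m * n))) = to_ac (to_fract
      (hom_subst (m ^ 2) (psi_sq gcurve m) (theta gcurve n) (psi_sq gcurve n)))"
    unfolding subst[OF d] unfolding psi[symmetric] psiE[symmetric] by (rule comp)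
  then show "psi_sq gcurve (m * n) = hom_subst (m ^ 2) (psi_sq gcurve m) (theta gcurve n) (psi_sq gcurve n)"
    by simp
  have d: "degree (theta gcurve m) \<le> m ^ 2"
    using top_coeff_theta[of m gcurve] m by (auto simp: top_coeff_def)
  have "to_ac (to_fract (theta gcurve (m * n))) = to_ac (to_fract
      (hom_subst (m ^ 2) (theta gcurve m) (theta gcurve n) (psi_sq gcurve n)))"
    unfolding subst[OF d] unfolding theta[symmetric] thetaE[symmetric] by (rule comp)
  then show "theta gcurve (m * n) = hom_subst (m ^ 2) (theta gcurve m) (theta gcurve n) (psi_sq gcurve n)"
    by simp
qed

lemma delta_composition:
  fixes E :: "'a::comm_ring_1 wcurve"
  assumes n: "n \<ge> 2" and m: "m \<ge> 1"
  shows "delta E P (m * n) = hom_subst (m ^ 2) (delta E P m) (theta E n) (psi_sq E n)"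
proof -
  obtain h where h: "ring_map h" and E: "E = map_wcurve h gcurve"
    using gcurve_specialise[of E] by auto
  interpret h: ring_map h by (rule h)
  have "psi_sq E (m * n) = hom_subst (m ^ 2) (psi_sq E m) (theta E n) (psi_sq E n)"
    "theta E (m * n) = hom_subst (m ^ 2) (theta E m) (theta E n) (psi_sq E n)"
    unfolding E h.psi_sq_map h.theta_map composition_gcurve[OF n m]
    by (rule h.map_poly_hom_subst)+
  then show ?thesis
    by (simp add: delta_def hom_subst_diff hom_subst_const del: mult_pCons_left split: option.split prod.split)
qed

section \<open>The tower law for simple algebraic extensions\<close>

subsection \<open>Degrees of algebraic elements\<close>

lemma irreducible_mult_unit:
  fixes g k :: "'a::comm_semiring_1"
  assumes g: "irreducible g" and k: "k * k' = 1"
  shows "irreducible (g * k)"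
proof (rule irreducibleI)
  have gkk: "g * k * k' = g" using k by (simp add: mult.assoc)
  show "g * k \<noteq> 0" using gkk g by auto
  show "\<not> g * k dvd 1" using g dvd_mult_left by (auto simp: irreducible_def)
  fix a b assume "g * k = a * b"
  then have "g = a * (b * k')" using gkk by (simp add: mult.assoc)
  then have "a dvd 1 \<or> b * k' dvd 1" by (rule irreducibleD[OF g])
  then show "a dvd 1 \<or> b dvd 1" using dvd_mult_left by blast
qed

locale field_map = ring_map h for h :: "'a::field \<Rightarrow> 'b::field"
begin

lemma eq_0_iff: "h c = 0 \<longleftrightarrow> c = 0"
proof
  assume "h c = 0"
  show "c = 0"
  proof (rule ccontr)
    assume "c \<noteq> 0"
    then have "h c * h (inverse c) = 1" by (simp flip: mult one)
    then show False using \<open>h c = 0\<close> by simp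
  qed
qed (simp add: zero)

sublocale vs: vector_space "\<lambda>c v. h c * v"
  by standard (simp_all add: add mult one algebra_simps)

abbreviation ev :: "'b \<Rightarrow> 'a poly \<Rightarrow> 'b" where
  "ev a p \<equiv> poly (map_poly h p) a"

sublocale ev: ring_map "ev a" for a
  by (rule ring_map_eval)

lemma ev_const: "ev a [:c:] = h c"
  by (simp add: map_poly_pCons)

lemma ev_monom: "ev a (monom c i) = h c * a ^ i"
  by (simp add: map_poly_monom zero poly_monom)

lemma ev_mod:
  assumes "ev a g = 0"
  shows "ev a (q mod g) = ev a q"
proof -
  have "ev a q = ev a (g * (q div g) + q mod g)" by simp
  also have "\<dots> = ev a (q mod g)" unfolding ev.add ev.mult assms by simp
  finally show ?thesis by simp
qed

lemma minimal_polynomial: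
  assumes "p \<noteq> 0" "ev a p = 0"
  obtains g where "irreducible g" "ev a g = 0" "\<And>q. ev a q = 0 \<Longrightarrow> g dvd q"
proof -
  obtain g where g: "g \<noteq> 0 \<and> ev a g = 0"
    and min: "\<And>q. q \<noteq> 0 \<and> ev a q = 0 \<Longrightarrow> degree g \<le> degree q"
    using assms ex_has_least_nat[of "\<lambda>q. q \<noteq> 0 \<and> ev a q = 0" p degree] by blast
  have dvd: "g dvd q" if "ev a q = 0" for q
  proof -
    have "ev a (q mod g) = 0" using ev_mod that g by simp
    then have "q mod g = 0" using min[of "q mod g"] degree_mod_less[of g q] g by force
    then show ?thesis by blast
  qed
  moreover have "irreducible g"
  proof (rule irreducibleI)
    show "g \<noteq> 0" using g by blast
    show "\<not> g dvd 1"
    proof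
      assume "g dvd 1"
      then obtain k where "1 = g * k" by (rule dvdE)
      then have "ev a (g * k) = 1" using ev.one by simp
      then show False using g by (simp add: ev.mult)
    qed
    fix p q assume pq: "g = p * q"
    then have "ev a p = 0 \<or> ev a q = 0" using g by (simp add: ev.mult)
    then have "g dvd p \<or> g dvd q" using dvd by blast
    then show "p dvd 1 \<or> q dvd 1"
      using pq g by (metis dvd_mult_cancel_left dvd_mult_cancel_right mult.commute mult.right_neutral)
  qed
  ultimately show thesis using that g by blast
qed

lemma irreducible_dvd_if_root:
  assumes f: "irreducible f" "ev a f = 0" and "ev a q = 0"
  shows "f dvd q"
proof -
  have "f \<noteq> 0" using f by auto
  then obtain g where g: "irreducible g" "\<And>q. ev a q = 0 \<Longrightarrow> g dvd q"
    using minimal_polynomial[of f a] f by blast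
  then obtain k where k: "f = g * k" using f by blast
  then have "k dvd 1" using f(1) g(1) irreducibleD irreducible_not_unit by blast
  then have "f dvd g" unfolding k by (metis dvd_refl mult.right_neutral mult_dvd_mono)
  then show ?thesis using g(2)[OF assms(3)] dvd_trans by blast
qed

text \<open>K[a] is a field for algebraic \<open>a\<close>. Euclidean descent: dividing the minimal
  polynomial \<open>g\<close> by \<open>q\<close> leaves a remainder \<open>r\<close> of smaller
  degree whose value is a multiple of that of \<open>q\<close>; it is nonzero because its degree is
  below that of \<open>g\<close>.\<close>

lemma ev_inverse:
  assumes p: "p \<noteq> 0" "ev a p = 0" and "ev a q \<noteq> 0"
  shows "\<exists>r. ev a q * ev a r = 1"
proof -
  obtain g where g: "irreducible g" "ev a g = 0" "\<And>q. ev a q = 0 \<Longrightarrow> g dvd q"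
    using minimal_polynomial[OF p] by blast
  have "g \<noteq> 0" using g(1) by auto
  have low: "\<exists>r. ev a q * ev a r = 1" if "ev a q \<noteq> 0" "degree q < degree g" for q
    using that
  proof (induction "degree q" arbitrary: q rule: less_induct)
    case less
    have "q \<noteq> 0" using less.prems by (auto simp: ev.zero)
    show ?case
    proof (cases "degree q = 0")
      case True
      then obtain c where c: "q = [:c:]" using degree_0_id by metis
      then have "ev a q * ev a [:inverse c:] = 1"
        using less.prems(1) unfolding c ev_const by (simp add: eq_0_iff flip: mult one)
      then show ?thesis by blast
    next
      case False
      define r where "r = g mod q"
      have r: "g = q * (g div q) + r" by (simp add: r_def)
      have "r \<noteq> 0"
      proof
        assume "r = 0"
        then have gq: "g = q * (g div q)" using r by simp
        then have "g div q \<noteq> 0" using \<open>g \<noteq> 0\<close> by auto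
        have "q dvd 1 \<or> g div q dvd 1" using gq by (rule irreducibleD[OF g(1)])
        then have "degree (g div q) = 0"
          using False is_unit_iff_degree[OF \<open>q \<noteq> 0\<close>] is_unit_iff_degree[OF \<open>g div q \<noteq> 0\<close>] by simp
        moreover have "degree g = degree q + degree (g div q)"
          by (subst gq) (rule degree_mult_eq[OF \<open>q \<noteq> 0\<close> \<open>g div q \<noteq> 0\<close>])
        ultimately show False using less.prems by simp
      qed
      then have dr: "degree r < degree q"
        using degree_mod_less[OF \<open>q \<noteq> 0\<close>, of g] by (auto simp: r_def)
      have "ev a r \<noteq> 0"
      proof
        assume "ev a r = 0"
        then have "degree g \<le> degree r" using g(3) \<open>r \<noteq> 0\<close> by (simp add: dvd_imp_degree_le)
        then show False using dr less.prems by simp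
      qed
      then obtain r' where r': "ev a r * ev a r' = 1"
        using less.hyps[of r] dr less.prems by auto
      have "ev a r = ev a (g - q * (g div q))" using r by (metis add_diff_cancel_left')
      then have "ev a r = - (ev a q * ev a (g div q))" using g(2) unfolding ev.diff ev.mult by simp
      then have "ev a q * ev a (- (g div q) * r') = ev a r * ev a r'"
        unfolding ev.minus ev.mult by simp
      then have "ev a q * ev a (- (g div q) * r') = 1" using r' by simp
      then show ?thesis by blast
    qed
  qed
  have eq: "ev a (q mod g) = ev a q"
    using g(2) by (rule ev_mod)
  then have "degree (q mod g) < degree g"
    using degree_mod_less[OF \<open>g \<noteq> 0\<close>, of q] assms(3) by (auto simp: ev.zero)
  then show ?thesis using low[of "q mod g"] eq assms(3) by simp
qed

lemma independent_family:
  assumes "finite J" and indep: "\<And>c. (\<Sum>j\<in>J. h (c j) * v j) = 0 \<Longrightarrow> \<forall>j\<in>J. c j = 0"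
  shows "inj_on v J" "vs.independent (v ` J)"
proof -
  show inj: "inj_on v J"
  proof (rule inj_onI, rule ccontr)
    fix i j assume ij: "i \<in> J" "j \<in> J" "v i = v j" "i \<noteq> j"
    define c where "c = (\<lambda>k. if k = i then 1 else if k = j then -1 else 0 :: 'a)"
    have "(\<Sum>k\<in>J. h (c k) * v k) = (\<Sum>k\<in>{i, j}. h (c k) * v k)"
      using ij assms(1) by (intro sum.mono_neutral_right) (auto simp: c_def zero)
    also have "\<dots> = 0" using ij by (simp add: c_def one minus)
    finally show False using indep[of c] ij by (auto simp: c_def)
  qed
  show "vs.independent (v ` J)"
  proof (rule vs.independent_if_scalars_zero)
    fix c w assume "(\<Sum>x\<in>v ` J. h (c x) * x) = 0" "w \<in> v ` J"
    then show "c w = 0" using indep[of "c \<circ> v"] by (auto simp: sum.reindex[OF inj])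
  qed (use assms(1) in simp)
qed

text \<open>The tower law for K(b) inside K(a), by counting two bases of \<open>L = K(a)\<close>
  over K: the powers of \<open>a\<close>, and the products of powers of \<open>b\<close> with a
  K(b)-basis \<open>I\<close>. Scalars from K(b) are written as values
  \<open>ev b q\<close>.\<close>

theorem degree_dvd_degree:
  assumes f: "irreducible f" "ev b f = 0" and g: "irreducible g" "ev a g = 0"
    and b: "b = ev a p"
  shows "degree f dvd degree g"
proof -
  define L where "L = range (ev a)"
  define d N where "d = degree f" and "N = degree g"
  have nz: "f \<noteq> 0" "g \<noteq> 0" using f g by auto
  have L_mult: "u * w \<in> L" if "u \<in> L" "w \<in> L" for u w
    using that by (auto simp: L_def simp flip: ev.mult)
  have b_L: "b ^ j \<in> L" for j
    by (auto simp: L_def b simp flip: ev.power)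
  have small: "q = 0" if "ev c q = 0" "irreducible k" "ev c k = 0" "degree q < degree k" for q k c
    using dvd_imp_degree_le[OF irreducible_dvd_if_root[OF that(2,3,1)]] that(4) by (cases "q = 0") auto
  have coeff0: "\<forall>i<n. c i = 0" if "(\<Sum>i<n. monom (c i) i) = 0" for c :: "nat \<Rightarrow> 'a" and n
  proof (intro allI impI)
    fix i assume "i < n"
    then have "coeff (\<Sum>i<n. monom (c i) i) i = c i" by (simp add: coeff_sum)
    then show "c i = 0" using that by simp
  qed
  have deg_lt: "degree (\<Sum>i<n. monom (c i) i) < n" if "n > 0" for c :: "nat \<Rightarrow> 'a" and n
    using that by (intro degree_sum_less) (auto intro: le_less_trans[OF degree_monom_le])
  have ev_sum: "ev c (\<Sum>i<n. monom (e i) i) = (\<Sum>i<n. h (e i) * c ^ i)" for c e n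
    by (simp add: ev.sum ev_monom)
  have pos: "d > 0" "N > 0"
    using f(1) g(1) nz irreducible_not_unit is_unit_iff_degree unfolding d_def N_def by blast+

  define B where "B = (\<lambda>i. a ^ i) ` {..<N}"
  have indep_B: "\<forall>i\<in>{..<N}. c i = 0" if "(\<Sum>i<N. h (c i) * a ^ i) = 0" for c
  proof -
    have "(\<Sum>i<N. monom (c i) i) = 0"
      using small[OF _ g] deg_lt[OF pos(2)] that by (simp add: ev_sum N_def)
    then show ?thesis using coeff0 by simp
  qed
  have B: "inj_on (\<lambda>i. a ^ i) {..<N}"
    by (rule independent_family(1)[OF finite_lessThan]) (rule indep_B)
  have indep_B: "vs.independent B"
    unfolding B_def by (rule independent_family(2)[OF finite_lessThan]) (rule indep_B)
  have card_B: "card B = N" "finite B" using B by (simp_all add: B_def card_image)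
  have red: "ev c q = (\<Sum>i<degree k. h (coeff (q mod k) i) * c ^ i)"
    if "k \<noteq> 0" "degree k > 0" "ev c k = 0" for c q k
  proof -
    have "ev c q = ev c (q mod k)"
      using ev_mod[OF that(3)] by simp
    also have "q mod k = (\<Sum>i<degree k. monom (coeff (q mod k) i) i)"
    proof (rule poly_eqI)
      fix i
      show "coeff (q mod k) i = coeff (\<Sum>i<degree k. monom (coeff (q mod k) i) i) i"
        using degree_mod_less[OF that(1), of q] that(2)
        by (auto simp: coeff_sum intro!: coeff_eq_0)
    qed
    also have "ev c \<dots> = (\<Sum>i<degree k. h (coeff (q mod k) i) * c ^ i)" by (rule ev_sum)
    finally show ?thesis .
  qed
  have L_B: "L \<subseteq> vs.span B"
  proof
    fix v assume "v \<in> L"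
    then obtain q where "v = ev a q" by (auto simp: L_def)
    then show "v \<in> vs.span B" unfolding red[OF nz(2) pos(2)[unfolded N_def] g(2), of q]
      by (auto simp: B_def N_def intro!: vs.span_sum intro: vs.span_scale vs.span_base)
  qed
  have B_L: "B \<subseteq> L"
  proof
    fix v assume "v \<in> B"
    then obtain i where "v = a ^ i" by (auto simp: B_def)
    then have "v = ev a (monom 1 i)" by (simp add: ev_monom one)
    then show "v \<in> L" by (simp add: L_def)
  qed

  \<comment> \<open>\<open>Q I\<close> says that \<open>I\<close> is linearly independent over the subfield generated by \<open>b\<close>; a maximal
    such \<open>I\<close> yields the basis \<open>C I\<close> of the tower law.\<close>
  define Q where "Q I \<longleftrightarrow> finite I \<and> I \<subseteq> L \<and>
    (\<forall>q. (\<Sum>e\<in>I. ev b (q e) * e) = 0 \<longrightarrow> (\<forall>e\<in>I. ev b (q e) = 0))" for I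
  have Q_D: "ev b (q e) = 0" if "Q I" "(\<Sum>e\<in>I. ev b (q e) * e) = 0" "e \<in> I" for I q e
    using that unfolding Q_def by blast
  define C where "C I = (\<lambda>(j, e). b ^ j * e) ` ({..<d} \<times> I)" for I
  have C: "card (C I) = d * card I" "vs.independent (C I)" if "Q I" for I
  proof -
    have "finite I" using that by (simp add: Q_def)
    have indep: "\<forall>x\<in>{..<d} \<times> I. c x = 0"
      if "(\<Sum>x\<in>{..<d} \<times> I. h (c x) * (case x of (j, e) \<Rightarrow> b ^ j * e)) = 0" for c
    proof -
      have "(\<Sum>e\<in>I. ev b (\<Sum>j<d. monom (c (j, e)) j) * e)
          = (\<Sum>x\<in>{..<d} \<times> I. h (c x) * (case x of (j, e) \<Rightarrow> b ^ j * e))"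
        unfolding ev_sum sum_distrib_right sum.swap[of _ "{..<d}" I]
        by (simp add: sum.cartesian_product split_def mult.assoc)
      then have sum0: "(\<Sum>e\<in>I. ev b (\<Sum>j<d. monom (c (j, e)) j) * e) = 0"
        using that by simp
      have "(\<Sum>j<d. monom (c (j, e)) j) = 0" if "e \<in> I" for e
      proof (rule small[OF _ f])
        show "ev b (\<Sum>j<d. monom (c (j, e)) j) = 0" using Q_D[OF \<open>Q I\<close> sum0 that] .
        show "degree (\<Sum>j<d. monom (c (j, e)) j) < degree f"
          using deg_lt[OF pos(1), of "\<lambda>j. c (j, e)"] by (simp only: d_def)
      qed
      then have "c (j, e) = 0" if "e \<in> I" "j < d" for e j
        using coeff0[of "\<lambda>j. c (j, e)" d] that by blast
      then show ?thesis by auto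
    qed
    have J: "finite ({..<d} \<times> I)" using \<open>finite I\<close> by simp
    have "inj_on (\<lambda>(j, e). b ^ j * e) ({..<d} \<times> I)"
      by (rule independent_family(1)[OF J]) (rule indep)
    then show "card (C I) = d * card I" by (simp add: C_def card_image card_cartesian_product)
    show "vs.independent (C I)"
      unfolding C_def by (rule independent_family(2)[OF J]) (rule indep)
  qed
  have C_L: "C I \<subseteq> L" if "Q I" for I
    using that L_mult b_L by (auto simp: C_def Q_def)
  have le: "d * card I \<le> N" if "Q I" for I
    using vs.independent_span_bound[OF card_B(2) C(2)[OF that]] C_L[OF that] L_B C(1)[OF that] card_B
    by auto
  then have le': "card I \<le> N" if "Q I" for I
    using le[OF that] pos(1) by (intro order_trans[OF _ le[OF that]]) simp
  have bound: "\<forall>I. Q I \<longrightarrow> card I < Suc N" using le' by (simp add: less_Suc_eq_le)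
  have "Q {}" by (simp add: Q_def)
  then obtain I where I: "Q I" and max: "\<And>I'. Q I' \<Longrightarrow> card I' \<le> card I"
    using ex_has_greatest_nat[OF _ bound] by blast
  have fin: "finite I" using I by (simp add: Q_def)
  have "L \<subseteq> vs.span (C I)"
  proof
    fix v assume v: "v \<in> L"
    have "\<exists>q. v = (\<Sum>e\<in>I. ev b (q e) * e)"
    \<comment> \<open>If \<open>v\<close> is already in \<open>I\<close>, inserting it changes
      nothing and maximality gives no information.\<close>
    proof (cases "v \<in> I")
      case True
      have "(\<Sum>e\<in>I. ev b (if e = v then 1 else 0) * e) = (\<Sum>e\<in>I. if e = v then v else 0)"
        by (intro sum.cong) (auto simp: ev.simps)
      also have "\<dots> = v" using True fin by simp
      finally have eq: "(\<Sum>e\<in>I. ev b (if e = v then 1 else 0) * e) = v" .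
      show ?thesis by (rule exI[of _ "\<lambda>e. if e = v then 1 else 0"]) (simp only: eq)
    next
      case False
      \<comment> \<open>By maximality there is a relation involving \<open>v\<close>; independence
        of \<open>I\<close> makes the coefficient of \<open>v\<close> nonzero, hence invertible in
        K[b].\<close>
      then have "\<not> Q (insert v I)" using max[of "insert v I"] fin by auto
      then obtain q where q: "(\<Sum>e\<in>insert v I. ev b (q e) * e) = 0"
        and ne: "\<exists>e\<in>insert v I. ev b (q e) \<noteq> 0"
        using fin v I by (auto simp: Q_def)
      have sum0: "ev b (q v) * v + (\<Sum>e\<in>I. ev b (q e) * e) = 0"
        using q False fin by simp
      have "ev b (q v) \<noteq> 0"
      proof
        assume "ev b (q v) = 0"
        then have "\<forall>e\<in>I. ev b (q e) = 0" using sum0 Q_D[OF I, of q] by simp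
        then show False using ne \<open>ev b (q v) = 0\<close> by auto
      qed
      then obtain r where r: "ev b (q v) * ev b r = 1" using ev_inverse[OF nz(1) f(2)] by blast
      have "v = ev b r * (ev b (q v) * v)" using r by (simp add: mult_ac flip: mult.assoc)
      also have "ev b (q v) * v = - (\<Sum>e\<in>I. ev b (q e) * e)"
        using sum0 by (simp add: eq_neg_iff_add_eq_0)
      also have "ev b r * \<dots> = - ev b r * (\<Sum>e\<in>I. ev b (q e) * e)" by simp
      also have "\<dots> = (\<Sum>e\<in>I. ev b (- r * q e) * e)"
        by (simp add: sum_distrib_left ev.simps mult.assoc sum_negf)
      finally show ?thesis by (rule exI[of _ "\<lambda>e. - r * q e"])
    qed
    then obtain q where q: "v = (\<Sum>e\<in>I. ev b (q e) * e)" by blast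
    have "ev b (q e) * e \<in> vs.span (C I)" if "e \<in> I" for e
      unfolding red[OF nz(1) pos(1)[unfolded d_def] f(2)] sum_distrib_right mult.assoc
      by (intro vs.span_sum vs.span_scale vs.span_base) (use that in \<open>auto simp: C_def d_def\<close>)
    then show "v \<in> vs.span (C I)" unfolding q by (intro vs.span_sum)
  qed
  then have B_C: "B \<subseteq> vs.span (C I)" using B_L by blast
  have "finite (C I)" using fin by (simp add: C_def)
  then have "card B \<le> card (C I)" using vs.independent_span_bound[OF _ indep_B B_C] by simp
  then have "N = d * card I" using le[OF I] C(1)[OF I] card_B by simp
  then show ?thesis by (simp add: d_def N_def)
qed

end

section \<open>The degree comparison and the two cases of the point P\<close>

subsection \<open>Irreducibility\<close>

lemma top_coeff_delta:
  assumes "n > 0"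
  shows "top_coeff (delta E (Some P) n) (n ^ 2) 1"
proof -
  have "degree (psi_sq E n) < n ^ 2"
    using top_coeff_psi_sq[OF assms, of E] assms
    by (auto simp: top_coeff_def intro: le_less_trans)
  then have "top_coeff ([:fst P:] * psi_sq E n) (n ^ 2) 0"
    by (auto simp: top_coeff_def coeff_eq_0 intro: le_trans[OF degree_smult_le])
  from top_coeff_diff[OF top_coeff_theta[OF assms] this]
  show ?thesis by (simp add: delta_def split_def)
qed

text \<open>The degree of \<open>g\<close> is [K(a) : K]. Keeping \<open>m\<close> and
  \<open>n\<close> apart lets the lemma serve both factors.\<close>

lemma square_dvd_degree:
  fixes E :: "'a::field wcurve"
  assumes h: "field_map (h :: 'a \<Rightarrow> 'b::field)" and n: "n \<ge> 2" and m: "m \<ge> 2"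
    and irr: "irreducible (delta E (Some P) m)" "irreducible (delta E (Some P) n)"
    and n_nz: "of_nat n \<noteq> (0::'a)"
    and root: "poly (map_poly h (delta E (Some P) (m * n))) a = 0"
    and g: "irreducible g" "poly (map_poly h g) a = 0"
  shows "m ^ 2 dvd degree g"
proof -
  interpret field_map h by (rule h)
  let ?N = "m ^ 2" and ?D = "delta E (Some P)"
  have top: "degree (?D k) = k ^ 2" "coeff (?D k) (k ^ 2) = 1" if "k > 0" for k
    using top_coeff_delta[OF that, of E P] by (auto simp: top_coeff_def intro!: antisym le_degree)
  have comp: "?D (m * n) = hom_subst ?N (?D m) (theta E n) (psi_sq E n)"
    using n m by (intro delta_composition) simp_all
  have psi: "ev a (psi_sq E n) \<noteq> 0"
  proof
    assume psi0: "ev a (psi_sq E n) = 0"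
    \<comment> \<open>With a vanishing denominator only the top term of the homogenisation survives.
      Its coefficient is 1, so \<open>theta E n\<close> vanishes at \<open>a\<close> as
      well.\<close>
    have "ev a (?D (m * n)) = (\<Sum>i\<le>?N. h (coeff (?D m) i) * ev a (theta E n) ^ i * 0 ^ (?N - i))"
      unfolding comp hom_subst_def ev.sum ev.mult ev.power psi0 ev_const ..
    also have "\<dots> = (\<Sum>i\<in>{?N}. h (coeff (?D m) i) * ev a (theta E n) ^ i * 0 ^ (?N - i))"
      by (intro sum.mono_neutral_right) auto
    also have "\<dots> = ev a (theta E n) ^ ?N" using top(2)[of m] m by (simp add: one)
    finally have "ev a (theta E n) = 0" using root by simp
    then have "ev a (?D n) = 0"
      using psi0 by (simp add: delta_def split_def ev.diff ev.mult del: mult_pCons_left)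
    then have dvd: "?D n dvd psi_sq E n" using irreducible_dvd_if_root irr(2) psi0 by blast
    have c: "degree (psi_sq E n) \<le> n ^ 2 - 1" "coeff (psi_sq E n) (n ^ 2 - 1) = of_nat n ^ 2"
      using top_coeff_psi_sq[of n E] n by (auto simp: top_coeff_def)
    \<comment> \<open>The assumption on the characteristic makes the leading coefficient n^2
      nonzero.\<close>
    have "psi_sq E n \<noteq> 0" using c n_nz by auto
    then have "degree (?D n) \<le> n ^ 2 - 1" using dvd_imp_degree_le[OF dvd] c(1) by simp
    moreover have "n ^ 2 > 0" using n by simp
    ultimately show False using top(1)[of n] n by linarith
  qed
  have "g \<noteq> 0" using g by auto
  \<comment> \<open>The inverse of the denominator is again a polynomial value at \<open>a\<close>,
    which puts \<open>b\<close> in K[a].\<close>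
  then obtain r where r: "ev a (psi_sq E n) * ev a r = 1" using ev_inverse[OF \<open>g \<noteq> 0\<close> g(2) psi] by blast
  define b where "b = ev a (theta E n * r)"
  have "b * ev a (psi_sq E n) = ev a (theta E n) * (ev a (psi_sq E n) * ev a r)"
    by (simp only: b_def ev.mult mult_ac)
  then have "ev a (theta E n) = b * ev a (psi_sq E n)" by (simp add: r)
  from eval_hom_subst[OF eq_refl[OF top(1)] refl this] m root
  have "ev b (?D m) = 0" unfolding comp using psi by simp
  then have "degree (?D m) dvd degree g"
    using degree_dvd_degree[OF irr(1) _ g b_def] by blast
  then show ?thesis using top(1)[of m] m by simp
qed

lemma reducible_psi_sq:
  fixes E :: "'a::field wcurve"
  assumes "odd n" "n > 1" "of_nat n \<noteq> (0::'a)"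
  shows "reducible_poly (psi_sq E n)"
proof -
  obtain i where i: "n = 2 * i + 1" using assms(1) by (rule oddE)
  have top: "degree (psit E n) \<le> 2 * i ^ 2 + 2 * i" "coeff (psit E n) (2 * i ^ 2 + 2 * i) = of_nat n"
    using top_coeff_psit_odd[of E i] unfolding i by (auto simp: top_coeff_def)
  then have nz: "psit E n \<noteq> 0" using assms(3) by auto
  have "2 * i ^ 2 + 2 * i \<le> degree (psit E n)" using top(2) assms(3) by (intro le_degree) simp
  then have deg: "degree (psit E n) > 0" using i assms(2) by simp
  have sq: "psi_sq E n = psit E n * psit E n" using assms(1) by (simp add: psi_sq_def power2_eq_square)
  have "\<not> psit E n dvd 1" using deg is_unit_iff_degree[OF nz] by simp
  then have "\<not> irreducible (psi_sq E n)" unfolding sq using irreducibleD by blast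
  moreover have "degree (psi_sq E n) > 0" unfolding sq using deg nz by (simp add: degree_mult_eq)
  ultimately show ?thesis by (simp add: reducible_poly_def)
qed

theorem theorem5p2:
  fixes E :: "'a::field wcurve" and P :: "('a \<times> 'a) option" and m d1 d2 :: nat
  assumes "elliptic_curve E"
    and "on_curve E P"
    and "m = d1 * d2" and "d1 > 1" and "d2 > 1" and "coprime d1 d2"
    and "of_nat m \<noteq> (0::'a)"
    and "reducible_poly (delta E P m)"
  shows "reducible_poly (delta E P d1) \<or> reducible_poly (delta E P d2)"
proof (cases P)
  case None
  \<comment> \<open>Coprime numbers are not both even.\<close>
  have "odd d1 \<or> odd d2" using \<open>coprime d1 d2\<close> by (metis coprime_common_divisor_nat dvd_refl odd_one coprime_def)
  moreover have "of_nat d1 \<noteq> (0::'a)" "of_nat d2 \<noteq> (0::'a)" using assms(3,7) by auto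
  ultimately show ?thesis using reducible_psi_sq assms(4,5) by (auto simp: None delta_def)
next
  case (Some Q)
  show ?thesis
  proof (rule ccontr)
    assume contra: "\<not> ?thesis"
    let ?D = "delta E (Some Q)"
    have deg: "degree (?D k) = k ^ 2" if "k > 0" for k
      using top_coeff_delta[OF that, of E Q] by (auto simp: top_coeff_def intro!: antisym le_degree)
    have irr: "irreducible (?D d1)" "irreducible (?D d2)"
      using contra deg[of d1] deg[of d2] assms(4,5) by (auto simp: reducible_poly_def Some)
    interpret field_map "to_ac :: 'a \<Rightarrow> 'a alg_closure" by standard simp_all
    have "m > 0" using assms by simp
    then have "degree (map_poly to_ac (?D m)) > 0"
      using deg[of m] degree_map_poly[of "to_ac :: 'a \<Rightarrow> _" "?D m"] by simp
    then obtain a where a: "ev a (?D m) = 0" using alg_closed_imp_poly_has_root by blast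
    have "?D m \<noteq> 0" using deg[of m] \<open>m > 0\<close> by auto
    then obtain g where g: "irreducible g" "ev a g = 0" "\<And>q. ev a q = 0 \<Longrightarrow> g dvd q"
      using minimal_polynomial[of "?D m" a] a by blast
    have nz: "of_nat d1 \<noteq> (0::'a)" "of_nat d2 \<noteq> (0::'a)" using assms(3,7) by auto
    have "d1 ^ 2 dvd degree g"
      using square_dvd_degree[OF field_map_axioms, of d2 d1] assms(3-5) irr nz a g by simp
    moreover have "d2 ^ 2 dvd degree g"
      using square_dvd_degree[OF field_map_axioms, of d1 d2] assms(3-5) irr nz a g
      by (simp add: mult.commute)
    ultimately have "m ^ 2 dvd degree g"
      using assms(3,6) by (simp add: power_mult_distrib divides_mult)
    moreover obtain k where k: "?D m = g * k" using g(3) a by blast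
    have "g \<noteq> 0" "k \<noteq> 0" using k \<open>?D m \<noteq> 0\<close> by auto
    \<comment> \<open>The positive degree of \<open>g\<close> is a multiple of m^2 and at most m^2,
      so the cofactor \<open>k\<close> is a unit.\<close>
    have dg: "degree g + degree k = m ^ 2"
      using deg[of m] \<open>m > 0\<close> degree_mult_eq[OF \<open>g \<noteq> 0\<close> \<open>k \<noteq> 0\<close>] by (simp add: k)
    moreover have "degree g > 0" using g(1) \<open>g \<noteq> 0\<close> irreducible_not_unit is_unit_iff_degree by blast
    ultimately have "m ^ 2 \<le> degree g" by (simp add: dvd_imp_le)
    then have "degree k = 0" using dg by simp
    then have "k dvd 1" using \<open>k \<noteq> 0\<close> is_unit_iff_degree by blast
    then have "irreducible (?D m)" unfolding k using irreducible_mult_unit[OF g(1)] by (metis dvdE)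
    then show False using assms(8) by (simp add: reducible_poly_def Some)
  qed
qed

end
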